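(* For two discrete probability distributions $\boldsymbol{u},\boldsymbol{v}\in\mathbb{R}^N$ on a one-dimensional uniform mesh grid with spacing $h$, the FS-2 algorithm (the implementation of the IPOT iteration described in the context) for computing the Wasserstein-1 metric $W_1(\boldsymbol{u},\boldsymbol{v})$ has $O(N)$ complexity. Specifically: (a) the initial matrix $\Gamma=\mathbf{1}_N\mathbf{1}_N^T$ lies in $\mathcal{C}^N$ and only four vectors $(\boldsymbol{\gamma},\boldsymbol{\gamma}',\boldsymbol{r},\boldsymbol{r}')$ are needed to represent it; (b) the matrix Hadamard product $Q=K\odot\Gamma$ lies in $\mathcal{C}^N$ and is obtained with $O(N)$ cost by updating the four representation vectors; (c) the matrix-vector multiplications $Q^T\boldsymbol{\phi}$ and $Q\boldsymbol{\psi}$ are implemented with $O(N)$ cost; (d) the matrix scaling $\Gamma=\mathrm{diag}(\boldsymbol{\phi})\,Q\,\mathrm{diag}(\boldsymbol{\psi})$ lies in $\mathcal{C}^N$ and is obtained with $O(N)$ cost by updating the four representation vectors; (e) the final value $W_1(\boldsymbol{u},\boldsymbol{v})=\langle C,\Gamma\rangle$ is obtained with $O(N)$ cost.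
   Context: Notation: $\odot$ is the Hadamard (entrywise) product, $\oslash$ is entrywise division of vectors, $\mathbf{1}_N$ is the all-ones vector in $\mathbb{R}^N$, $\langle A,B\rangle=\sum_{i,j}a_{ij}b_{ij}$. The vectors $\boldsymbol{u},\boldsymbol{v}$ have nonnegative entries summing to $1$. The cost matrix is $C=[c_{ij}]$ with $c_{ij}=h|i-j|$; $\delta$ is the regularization parameter, $\lambda=e^{-h/\delta}$, and the kernel matrix is $K=[e^{-c_{ij}/\delta}]=[\lambda^{|i-j|}]\in\mathbb{R}^{N\times N}$. IPOT iteration (inexact proximal point method for optimal transport), with positive integer parameters itr_max (outer steps) and $L$ (inner steps): initialize $\boldsymbol{\phi}=\boldsymbol{\psi}=\frac1N\mathbf{1}_N$ and $\Gamma=\mathbf{1}_N\mathbf{1}_N^T$. For $t=1,\dots,$ itr_max: set $Q\leftarrow K\odot\Gamma$; for $\ell=1,\dots,L$ set $\boldsymbol{\psi}\leftarrow\boldsymbol{v}\oslash(Q^T\boldsymbol{\phi})$ and then $\boldsymbol{\phi}\leftarrow\boldsymbol{u}\oslash(Q\boldsymbol{\psi})$; then set $\Gamma\leftarrow\mathrm{diag}(\boldsymbol{\phi})\,Q\,\mathrm{diag}(\boldsymbol{\psi})$. The output is $\langle C,\Gamma\rangle$. Matrix classes: $\mathcal{C}_L^N$ is the set of $M=[m_{i,j}]\in\mathbb{R}^{N\times N}$ with $m_{i,j}=0$ for $i<j$ and $m_{i+1,j}/m_{i,j}=r_i$ for $j\le i$, for some ratio vector $\boldsymbol{r}\in(\mathbb{R}\setminus\{0\})^{N-1}$;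 such a matrix is represented by its diagonal $\boldsymbol{\gamma}$ and $\boldsymbol{r}$. $\mathcal{C}_U^N$ is the set of $M\in\mathbb{R}^{N\times N}$ with $m_{i,j}=0$ for $i\ge j$ and $m_{i-1,j}/m_{i,j}=r'_{i-1}$ for $i<j$, for some ratio vector $\boldsymbol{r}'\in(\mathbb{R}\setminus\{0\})^{N-2}$; such a matrix is represented by its superdiagonal $\boldsymbol{\gamma}'$ and $\boldsymbol{r}'$. $\mathcal{C}^N=\{A+B: A\in\mathcal{C}_L^N,\ B\in\mathcal{C}_U^N\}$, so an element is represented by four vectors $(\boldsymbol{\gamma},\boldsymbol{\gamma}',\boldsymbol{r},\boldsymbol{r}')$. Matrix scaling of these classes is considered for diagonal vectors with nonzero entries. FS-2 algorithm: the IPOT iteration in which $K$, $\Gamma$ and $Q$ are never stored as matrices but handled through their representation vectors as elements of $\mathcal{C}^N$. The Hadamard product and the scaling are performed by updating the representation vectors. The product of an element of $\mathcal{C}^N$ with a vector $\boldsymbol{y}$ is computed as $\boldsymbol{p}+\boldsymbol{q}$, where $p_1=\gamma_1y_1$, $p_{i+1}=r_ip_i+\gamma_{i+1}y_{i+1}$ for $1\le i\le N-1$, and $q_N=0$, $q_{N-1}=\gamma'_{N-1}y_N$, $q_{N-i}=r'_{N-i}q_{N-i+1}+\gamma'_{N-i}y_{N-i+1}$ for $2\le i\le N-1$. The final value $\langle C,\Gamma\rangle$ is computed as the sum of all entries of $C\odot\Gamma$, whose row sums over the lower and over the strictly upper triangular part are obtained recursively from row to row. *)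

theory Defs
  imports Complex_Main "HOL-Library.Monad_Syntax" "Jordan_Normal_Form.Matrix"
begin

text \<open>Vectors and matrices over the mesh are \<^typ>\<open>real vec\<close> and \<^typ>\<open>real mat\<close>; all indices
  are shifted by one and run from 0 to \<open>N - 1\<close>.\<close>

section \<open>The IPOT iteration\<close>

definition hadamard :: "real mat \<Rightarrow> real mat \<Rightarrow> real mat" (infixl \<open>\<odot>\<^sub>m\<close> 70) where
  "A \<odot>\<^sub>m B = mat (dim_row A) (dim_col A) (\<lambda>(i, j). A $$ (i, j) * B $$ (i, j))"

definition vec_divide :: "real vec \<Rightarrow> real vec \<Rightarrow> real vec" (infixl \<open>\<oslash>\<^sub>v\<close> 70) where
  "x \<oslash>\<^sub>v y = vec (dim_vec x) (\<lambda>i. x $ i / y $ i)"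

definition frobenius :: "real mat \<Rightarrow> real mat \<Rightarrow> real" where
  "frobenius A B = (\<Sum>i<dim_row A. \<Sum>j<dim_col A. A $$ (i, j) * B $$ (i, j))"

definition diag_of :: "real vec \<Rightarrow> real mat" where
  "diag_of x = mat_diag (dim_vec x) (\<lambda>i. x $ i)"

definition ones_mat :: "nat \<Rightarrow> real mat" where
  "ones_mat N = mat N N (\<lambda>_. 1)"

definition cost_mat :: "nat \<Rightarrow> real \<Rightarrow> real mat" where
  "cost_mat N h = mat N N (\<lambda>(i, j). h * \<bar>real i - real j\<bar>)"

definition kernel_mat :: "nat \<Rightarrow> real \<Rightarrow> real \<Rightarrow> real mat" where
  "kernel_mat N h \<delta> = map_mat (\<lambda>c. exp (- c / \<delta>)) (cost_mat N h)"

definition prob_vec :: "nat \<Rightarrow> real vec \<Rightarrow> bool" where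
  "prob_vec N x \<longleftrightarrow> x \<in> carrier_vec N \<and> (\<forall>i<N. 0 \<le> x $ i) \<and> (\<Sum>i<N. x $ i) = 1"

definition nonzero_vec :: "nat \<Rightarrow> real vec \<Rightarrow> bool" where
  "nonzero_vec N x \<longleftrightarrow> x \<in> carrier_vec N \<and> (\<forall>i<N. x $ i \<noteq> 0)"

definition ipot_inner ::
  "real mat \<Rightarrow> real vec \<Rightarrow> real vec \<Rightarrow> real vec \<times> real vec \<Rightarrow> real vec \<times> real vec" where
  "ipot_inner Q u v = (\<lambda>(\<phi>, \<psi>).
     let \<psi>' = v \<oslash>\<^sub>v (transpose_mat Q *\<^sub>v \<phi>);
         \<phi>' = u \<oslash>\<^sub>v (Q *\<^sub>v \<psi>')
     in (\<phi>', \<psi>'))"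

definition ipot_outer ::
  "real mat \<Rightarrow> real vec \<Rightarrow> real vec \<Rightarrow> nat \<Rightarrow>
   real vec \<times> real vec \<times> real mat \<Rightarrow> real vec \<times> real vec \<times> real mat" where
  "ipot_outer K u v L = (\<lambda>(\<phi>, \<psi>, \<Gamma>).
     let Q = K \<odot>\<^sub>m \<Gamma>;
         (\<phi>', \<psi>') = (ipot_inner Q u v ^^ L) (\<phi>, \<psi>)
     in (\<phi>', \<psi>', diag_of \<phi>' * Q * diag_of \<psi>'))"

definition ipot_init :: "nat \<Rightarrow> real vec \<times> real vec \<times> real mat" where
  "ipot_init N = (vec N (\<lambda>_. 1 / real N), vec N (\<lambda>_. 1 / real N), ones_mat N)"

definition ipot_state ::
  "nat \<Rightarrow> real \<Rightarrow> real \<Rightarrow> real vec \<Rightarrow> real vec \<Rightarrow> nat \<Rightarrow> nat \<Rightarrow>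
   real vec \<times> real vec \<times> real mat" where
  "ipot_state N h \<delta> u v L t = (ipot_outer (kernel_mat N h \<delta>) u v L ^^ t) (ipot_init N)"

definition ipot_phi where "ipot_phi N h \<delta> u v L t = fst (ipot_state N h \<delta> u v L t)"
definition ipot_psi where "ipot_psi N h \<delta> u v L t = fst (snd (ipot_state N h \<delta> u v L t))"
definition ipot_plan where "ipot_plan N h \<delta> u v L t = snd (snd (ipot_state N h \<delta> u v L t))"

definition ipot :: "nat \<Rightarrow> real \<Rightarrow> real \<Rightarrow> real vec \<Rightarrow> real vec \<Rightarrow> nat \<Rightarrow> nat \<Rightarrow> real" where
  "ipot N h \<delta> u v L itr_max = frobenius (cost_mat N h) (ipot_plan N h \<delta> u v L itr_max)"

text \<open>Scaling vectors with a zero entry do not occur if \<open>u\<close> and \<open>v\<close> have positive entries.\<close>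

definition pos_vec :: "nat \<Rightarrow> real vec \<Rightarrow> bool" where
  "pos_vec N x \<longleftrightarrow> x \<in> carrier_vec N \<and> (\<forall>i<N. 0 < x $ i)"

definition pos_mat :: "nat \<Rightarrow> real mat \<Rightarrow> bool" where
  "pos_mat N A \<longleftrightarrow> A \<in> carrier_mat N N \<and> (\<forall>i<N. \<forall>j<N. 0 < A $$ (i, j))"

lemma pos_mat_mult_vec:
  assumes "pos_mat N A" "pos_vec N x"
  shows "pos_vec N (A *\<^sub>v x)"
proof -
  have "0 < (\<Sum>j\<in>{0..<N}. A $$ (i, j) * x $ j)" if "i < N" for i
    using assms that by (intro sum_pos) (auto simp: pos_mat_def pos_vec_def)
  then show ?thesis
    using assms by (auto simp: pos_mat_def pos_vec_def scalar_prod_def)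
qed

lemma pos_vec_divide: "pos_vec N x \<Longrightarrow> pos_vec N y \<Longrightarrow> pos_vec N (x \<oslash>\<^sub>v y)"
  by (auto simp: pos_vec_def vec_divide_def)

lemma pos_mat_transpose: "pos_mat N A \<Longrightarrow> pos_mat N (transpose_mat A)"
  by (auto simp: pos_mat_def)

lemma pos_mat_hadamard: "pos_mat N A \<Longrightarrow> pos_mat N B \<Longrightarrow> pos_mat N (A \<odot>\<^sub>m B)"
  by (auto simp: pos_mat_def hadamard_def)

lemma pos_mat_scale:
  assumes "pos_vec N x" "pos_mat N A" "pos_vec N y"
  shows "pos_mat N (diag_of x * A * diag_of y)"
proof -
  have A: "A \<in> carrier_mat N N" and d: "dim_vec x = N" "dim_vec y = N"
    using assms by (auto simp: pos_vec_def pos_mat_def)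
  show ?thesis
    unfolding diag_of_def d mat_diag_mult_left[OF A]
    by (subst mat_diag_mult_right[where nr = N])
      (use assms in \<open>auto simp: pos_vec_def pos_mat_def\<close>)
qed

lemma ipot_inner_pos:
  assumes "pos_mat N Q" "pos_vec N u" "pos_vec N v" "pos_vec N (fst s)" "pos_vec N (snd s)"
  shows "pos_vec N (fst ((ipot_inner Q u v ^^ l) s)) \<and> pos_vec N (snd ((ipot_inner Q u v ^^ l) s))"
  by (induction l)
    (use assms in \<open>auto simp: ipot_inner_def Let_def split_beta
      intro!: pos_vec_divide pos_mat_mult_vec pos_mat_transpose\<close>)

lemma ipot_state_pos:
  assumes "0 < N" "pos_vec N u" "pos_vec N v"
  shows "pos_vec N (ipot_phi N h \<delta> u v L t) \<and> pos_vec N (ipot_psi N h \<delta> u v L t) \<and>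
    pos_mat N (ipot_plan N h \<delta> u v L t)"
proof (induction t)
  case 0
  then show ?case
    using assms(1) by (auto simp: ipot_phi_def ipot_psi_def ipot_plan_def ipot_state_def
        ipot_init_def pos_vec_def pos_mat_def ones_mat_def)
next
  case (Suc t)
  have K: "pos_mat N (kernel_mat N h \<delta>)"
    by (auto simp: pos_mat_def kernel_mat_def cost_mat_def)
  let ?s = "ipot_state N h \<delta> u v L t"
  let ?Q = "kernel_mat N h \<delta> \<odot>\<^sub>m snd (snd ?s)"
  have Q: "pos_mat N ?Q"
    using Suc K by (auto simp: ipot_plan_def intro!: pos_mat_hadamard)
  have i: "pos_vec N (fst ((ipot_inner ?Q u v ^^ L) (fst ?s, fst (snd ?s))))"
    "pos_vec N (snd ((ipot_inner ?Q u v ^^ L) (fst ?s, fst (snd ?s))))"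
    using ipot_inner_pos[OF Q assms(2,3), of "(fst ?s, fst (snd ?s))" L] Suc
    by (auto simp: ipot_phi_def ipot_psi_def)
  have S: "ipot_state N h \<delta> u v L (Suc t) = ipot_outer (kernel_mat N h \<delta>) u v L ?s"
    by (simp add: ipot_state_def)
  show ?case
    unfolding ipot_phi_def ipot_psi_def ipot_plan_def S
    using i pos_mat_scale[OF i(1) Q i(2)] by (simp add: ipot_outer_def Let_def split_beta)
qed

lemma ipot_nonzero:
  assumes "0 < N" "pos_vec N u" "pos_vec N v"
  shows "nonzero_vec N (ipot_phi N h \<delta> u v L t)" "nonzero_vec N (ipot_psi N h \<delta> u v L t)"
  using ipot_state_pos[OF assms, of h \<delta> L t] by (auto simp: pos_vec_def nonzero_vec_def)

section \<open>Collinear triangular matrices\<close>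

text \<open>As \<open>x / 0 = 0\<close> and all ratios are nonzero, the ratio conditions below force every entry
  that occurs as a denominator to be nonzero, as the quotients in the definition presuppose.\<close>

definition lower_collinear :: "nat \<Rightarrow> real list \<Rightarrow> real mat \<Rightarrow> bool" where
  "lower_collinear N r M \<longleftrightarrow>
     M \<in> carrier_mat N N \<and> length r = N - 1 \<and> 0 \<notin> set r \<and>
     (\<forall>i j. i < j \<and> j < N \<longrightarrow> M $$ (i, j) = 0) \<and>
     (\<forall>i j. j \<le> i \<and> i + 1 < N \<longrightarrow> M $$ (i + 1, j) / M $$ (i, j) = r ! i)"

definition upper_collinear :: "nat \<Rightarrow> real list \<Rightarrow> real mat \<Rightarrow> bool" where
  "upper_collinear N r' M \<longleftrightarrow>
     M \<in> carrier_mat N N \<and> length r' = N - 2 \<and> 0 \<notin> set r' \<and>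
     (\<forall>i j. j \<le> i \<and> i < N \<longrightarrow> M $$ (i, j) = 0) \<and>
     (\<forall>i j. 0 < i \<and> i < j \<and> j < N \<longrightarrow> M $$ (i - 1, j) / M $$ (i, j) = r' ! (i - 1))"

definition C_L :: "nat \<Rightarrow> real mat set" where
  "C_L N = {M. \<exists>r. lower_collinear N r M}"

definition C_U :: "nat \<Rightarrow> real mat set" where
  "C_U N = {M. \<exists>r'. upper_collinear N r' M}"

definition C_mats :: "nat \<Rightarrow> real mat set" where
  "C_mats N = {A + B | A B. A \<in> C_L N \<and> B \<in> C_U N}"

text \<open>The four representation vectors \<open>(\<gamma>, \<gamma>', r, r')\<close>, of lengths \<open>N\<close>, \<open>N - 1\<close>, \<open>N - 1\<close>
  and \<open>N - 2\<close>.\<close>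

type_synonym crep = "real list \<times> real list \<times> real list \<times> real list"

definition represents :: "nat \<Rightarrow> crep \<Rightarrow> real mat \<Rightarrow> bool" where
  "represents N \<rho> M \<longleftrightarrow> (case \<rho> of (\<gamma>, \<gamma>', r, r') \<Rightarrow>
     \<exists>A B. M = A + B \<and> lower_collinear N r A \<and> upper_collinear N r' B \<and>
       \<gamma> = map (\<lambda>i. A $$ (i, i)) [0..<N] \<and>
       \<gamma>' = map (\<lambda>i. B $$ (i, i + 1)) [0..<N - 1])"

section \<open>Cost model\<close>

text \<open>A timed computation carries its result and its number of elementary steps. Every arithmetic
  operation on reals costs one step, and so does every call of a recursive function (\<open>tick\<close>); the
  remaining work per call is a bounded number of list constructor and selector operations.\<close>

datatype 'a timed = Timed (result: 'a) (cost: nat)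

definition return :: "'a \<Rightarrow> 'a timed" where
  "return x = Timed x 0"

definition timed_bind :: "'a timed \<Rightarrow> ('a \<Rightarrow> 'b timed) \<Rightarrow> 'b timed" where
  "timed_bind m f = Timed (result (f (result m))) (cost m + cost (f (result m)))"

adhoc_overloading Monad_Syntax.bind \<rightleftharpoons> timed_bind

definition tick :: "unit timed" where "tick = Timed () 1"

definition add_t :: "real \<Rightarrow> real \<Rightarrow> real timed" where "add_t x y = Timed (x + y) 1"
definition mul_t :: "real \<Rightarrow> real \<Rightarrow> real timed" where "mul_t x y = Timed (x * y) 1"
definition div_t :: "real \<Rightarrow> real \<Rightarrow> real timed" where "div_t x y = Timed (x / y) 1"
definition neg_t :: "real \<Rightarrow> real timed" where "neg_t x = Timed (- x) 1"
definition exp_t :: "real \<Rightarrow> real timed" where "exp_t x = Timed (exp x) 1"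

primrec iterate_t :: "nat \<Rightarrow> ('a \<Rightarrow> 'a timed) \<Rightarrow> 'a \<Rightarrow> 'a timed" where
  "iterate_t 0 f s = do { tick; return s }"
| "iterate_t (Suc n) f s = do { tick; s' \<leftarrow> iterate_t n f s; f s' }"

primrec fill_t :: "nat \<Rightarrow> real \<Rightarrow> real list timed" where
  "fill_t 0 x = do { tick; return [] }"
| "fill_t (Suc n) x = do { tick; xs \<leftarrow> fill_t n x; return (x # xs) }"

fun zip_with_t :: "(real \<Rightarrow> real \<Rightarrow> real timed) \<Rightarrow> real list \<Rightarrow> real list \<Rightarrow> real list timed" where
  "zip_with_t f (x # xs) (y # ys) =
     do { tick; z \<leftarrow> f x y; zs \<leftarrow> zip_with_t f xs ys; return (z # zs) }"
| "zip_with_t f _ _ = do { tick; return [] }"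

fun sum_t :: "real list \<Rightarrow> real timed" where
  "sum_t [] = do { tick; return 0 }"
| "sum_t (x # xs) = do { tick; s \<leftarrow> sum_t xs; add_t x s }"

section \<open>Operations on representation vectors\<close>

definition ones_rep :: "nat \<Rightarrow> crep timed" where
  "ones_rep N = do {
     \<gamma> \<leftarrow> fill_t N 1;
     \<gamma>' \<leftarrow> fill_t (N - 1) 1;
     r \<leftarrow> fill_t (N - 1) 1;
     r' \<leftarrow> fill_t (N - 2) 1;
     return (\<gamma>, \<gamma>', r, r') }"

definition kernel_rep :: "nat \<Rightarrow> real \<Rightarrow> real \<Rightarrow> crep timed" where
  "kernel_rep N h \<delta> = do {
     a \<leftarrow> neg_t h;
     b \<leftarrow> div_t a \<delta>;
     lam \<leftarrow> exp_t b;
     \<gamma> \<leftarrow> fill_t N 1;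
     \<gamma>' \<leftarrow> fill_t (N - 1) lam;
     r \<leftarrow> fill_t (N - 1) lam;
     r' \<leftarrow> fill_t (N - 2) lam;
     return (\<gamma>, \<gamma>', r, r') }"

definition hadamard_rep :: "crep \<Rightarrow> crep \<Rightarrow> crep timed" where
  "hadamard_rep = (\<lambda>(\<gamma>1, \<gamma>1', r1, r1') (\<gamma>2, \<gamma>2', r2, r2'). do {
     \<gamma> \<leftarrow> zip_with_t mul_t \<gamma>1 \<gamma>2;
     \<gamma>' \<leftarrow> zip_with_t mul_t \<gamma>1' \<gamma>2';
     r \<leftarrow> zip_with_t mul_t r1 r2;
     r' \<leftarrow> zip_with_t mul_t r1' r2';
     return (\<gamma>, \<gamma>', r, r') })"

text \<open>Entry \<open>(i, j)\<close> of the matrix is multiplied by \<open>\<phi>\<^sub>i \<psi>\<^sub>j\<close>, hence \<open>r\<^sub>i\<close> by \<open>\<phi>\<^sub>i\<^sub>+\<^sub>1 / \<phi>\<^sub>i\<close> and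
  \<open>r'\<^sub>i\<close> by its inverse; \<open>zip_with_t\<close> stops at the end of the shorter list.\<close>

definition scale_rep :: "real list \<Rightarrow> crep \<Rightarrow> real list \<Rightarrow> crep timed" where
  "scale_rep \<phi> = (\<lambda>(\<gamma>, \<gamma>', r, r') \<psi>. do {
     a \<leftarrow> zip_with_t mul_t \<phi> \<gamma>;
     \<gamma>1 \<leftarrow> zip_with_t mul_t a \<psi>;
     b \<leftarrow> zip_with_t mul_t \<phi> \<gamma>';
     \<gamma>1' \<leftarrow> zip_with_t mul_t b (tl \<psi>);
     q \<leftarrow> zip_with_t div_t (tl \<phi>) \<phi>;
     r1 \<leftarrow> zip_with_t mul_t r q;
     r1' \<leftarrow> zip_with_t div_t r' q;
     return (\<gamma>1, \<gamma>1', r1, r1') })"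

text \<open>\<open>lower_mv\<close> computes \<open>p\<close>; the first argument of \<open>lower_mv_from\<close> is the preceding \<open>p\<^sub>i\<close>.\<close>

fun lower_mv_from :: "real \<Rightarrow> real list \<Rightarrow> real list \<Rightarrow> real list \<Rightarrow> real list timed" where
  "lower_mv_from p (r # rs) (g # gs) (y # ys) = do {
     tick;
     a \<leftarrow> mul_t r p;
     b \<leftarrow> mul_t g y;
     p' \<leftarrow> add_t a b;
     ps \<leftarrow> lower_mv_from p' rs gs ys;
     return (p' # ps) }"
| "lower_mv_from _ _ _ _ = do { tick; return [] }"

fun lower_mv :: "real list \<Rightarrow> real list \<Rightarrow> real list \<Rightarrow> real list timed" where
  "lower_mv (g # gs) rs (y # ys) = do {
     tick;
     p \<leftarrow> mul_t g y;
     ps \<leftarrow> lower_mv_from p rs gs ys;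
     return (p # ps) }"
| "lower_mv _ _ _ = do { tick; return [] }"

text \<open>\<open>upper_mv \<gamma>' r' [y\<^sub>2, \<dots>, y\<^sub>N]\<close> computes \<open>q\<close> from its last entry \<open>q\<^sub>N = 0\<close> upwards.\<close>

fun upper_mv :: "real list \<Rightarrow> real list \<Rightarrow> real list \<Rightarrow> real list timed" where
  "upper_mv (g # gs) (r # rs) (y # ys) = do {
     tick;
     qs \<leftarrow> upper_mv gs rs ys;
     a \<leftarrow> mul_t r (hd qs);
     b \<leftarrow> mul_t g y;
     q \<leftarrow> add_t a b;
     return (q # qs) }"
| "upper_mv (g # gs) [] (y # ys) = do { tick; q \<leftarrow> mul_t g y; return [q, 0] }"
| "upper_mv _ _ _ = do { tick; return [0] }"

definition mv_rep :: "crep \<Rightarrow> real list \<Rightarrow> real list timed" where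
  "mv_rep = (\<lambda>(\<gamma>, \<gamma>', r, r') y. do {
     p \<leftarrow> lower_mv \<gamma> r y;
     q \<leftarrow> upper_mv \<gamma>' r' (tl y);
     zip_with_t add_t p q })"

text \<open>The transpose of \<open>A + B\<close> with \<open>A\<close> lower and \<open>B\<close> strictly upper collinear need not lie in the
  class again, but the product with \<open>y\<close> obeys the same kind of recursions:
  \<open>(A\<^sup>T y)\<^sub>j = \<gamma>\<^sub>j s\<^sub>j\<close> with \<open>s\<^sub>N = y\<^sub>N\<close>, \<open>s\<^sub>j = y\<^sub>j + r\<^sub>j s\<^sub>j\<^sub>+\<^sub>1\<close>, and \<open>(B\<^sup>T y)\<^sub>1 = 0\<close>,
  \<open>(B\<^sup>T y)\<^sub>j\<^sub>+\<^sub>1 = \<gamma>'\<^sub>j w\<^sub>j\<close> with \<open>w\<^sub>1 = y\<^sub>1\<close>, \<open>w\<^sub>j\<^sub>+\<^sub>1 = r'\<^sub>j w\<^sub>j + y\<^sub>j\<^sub>+\<^sub>1\<close>.\<close>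

fun backward_t :: "real list \<Rightarrow> real list \<Rightarrow> real list timed" where
  "backward_t (r # rs) (y # ys) = do {
     tick;
     ss \<leftarrow> backward_t rs ys;
     a \<leftarrow> mul_t r (hd ss);
     s \<leftarrow> add_t y a;
     return (s # ss) }"
| "backward_t [] (y # ys) = do { tick; return [y] }"
| "backward_t _ [] = do { tick; return [] }"

fun forward_from :: "real \<Rightarrow> real list \<Rightarrow> real list \<Rightarrow> real list timed" where
  "forward_from w (r # rs) (y # ys) = do {
     tick;
     a \<leftarrow> mul_t r w;
     w' \<leftarrow> add_t a y;
     ws \<leftarrow> forward_from w' rs ys;
     return (w' # ws) }"
| "forward_from _ _ _ = do { tick; return [] }"

fun forward_t :: "real list \<Rightarrow> real list \<Rightarrow> real list timed" where
  "forward_t rs (y # ys) = do { tick; ws \<leftarrow> forward_from y rs ys; return (y # ws) }"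
| "forward_t _ [] = do { tick; return [] }"

definition mv_transpose_rep :: "crep \<Rightarrow> real list \<Rightarrow> real list timed" where
  "mv_transpose_rep = (\<lambda>(\<gamma>, \<gamma>', r, r') y. do {
     s \<leftarrow> backward_t r y;
     p \<leftarrow> zip_with_t mul_t \<gamma> s;
     w \<leftarrow> forward_t r' y;
     q \<leftarrow> zip_with_t mul_t \<gamma>' w;
     zip_with_t add_t p (0 # q) })"

text \<open>Row sums \<open>S\<^sub>i\<close> of the lower triangular part of \<open>C \<odot> \<Gamma>\<close>, computed along with the row sums \<open>T\<^sub>i\<close>
  of the lower triangular part of \<open>\<Gamma>\<close>: as \<open>c\<^sub>i\<^sub>+\<^sub>1\<^sub>,\<^sub>j = c\<^sub>i\<^sub>j + h\<close> for \<open>j \<le> i\<close>,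
  \<open>S\<^sub>i\<^sub>+\<^sub>1 = r\<^sub>i (S\<^sub>i + h T\<^sub>i)\<close> and \<open>T\<^sub>i\<^sub>+\<^sub>1 = r\<^sub>i T\<^sub>i + \<gamma>\<^sub>i\<^sub>+\<^sub>1\<close>.\<close>

fun lower_rows_from :: "real \<Rightarrow> real \<Rightarrow> real \<Rightarrow> real list \<Rightarrow> real list \<Rightarrow> real list timed" where
  "lower_rows_from h S T (r # rs) (g # gs) = do {
     tick;
     a \<leftarrow> mul_t h T;
     b \<leftarrow> add_t S a;
     S' \<leftarrow> mul_t r b;
     c \<leftarrow> mul_t r T;
     T' \<leftarrow> add_t c g;
     Ss \<leftarrow> lower_rows_from h S' T' rs gs;
     return (S' # Ss) }"
| "lower_rows_from _ _ _ _ _ = do { tick; return [] }"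

fun lower_rows :: "real \<Rightarrow> real list \<Rightarrow> real list \<Rightarrow> real list timed" where
  "lower_rows h (g # gs) rs = do { tick; Ss \<leftarrow> lower_rows_from h 0 g rs gs; return (0 # Ss) }"
| "lower_rows _ [] _ = do { tick; return [] }"

text \<open>The same for the strictly upper triangular part, from the last row upwards:
  \<open>S'\<^sub>i = h \<gamma>'\<^sub>i + r'\<^sub>i (S'\<^sub>i\<^sub>+\<^sub>1 + h T'\<^sub>i\<^sub>+\<^sub>1)\<close> and \<open>T'\<^sub>i = \<gamma>'\<^sub>i + r'\<^sub>i T'\<^sub>i\<^sub>+\<^sub>1\<close>. The second component of the
  result is the topmost \<open>T'\<^sub>i\<close>.\<close>

fun upper_rows :: "real \<Rightarrow> real list \<Rightarrow> real list \<Rightarrow> (real list \<times> real) timed" where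
  "upper_rows h (g # gs) (r # rs) = do {
     tick;
     (Ss, T) \<leftarrow> upper_rows h gs rs;
     a \<leftarrow> mul_t h T;
     b \<leftarrow> add_t (hd Ss) a;
     c \<leftarrow> mul_t r b;
     d \<leftarrow> mul_t h g;
     S' \<leftarrow> add_t d c;
     e \<leftarrow> mul_t r T;
     T' \<leftarrow> add_t g e;
     return (S' # Ss, T') }"
| "upper_rows h (g # gs) [] = do { tick; S \<leftarrow> mul_t h g; return ([S, 0], g) }"
| "upper_rows _ [] _ = do { tick; return ([0], 0) }"

definition transport_cost_rep :: "real \<Rightarrow> crep \<Rightarrow> real timed" where
  "transport_cost_rep h = (\<lambda>(\<gamma>, \<gamma>', r, r'). do {
     Ss \<leftarrow> lower_rows h \<gamma> r;
     (Ss', _) \<leftarrow> upper_rows h \<gamma>' r';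
     a \<leftarrow> sum_t Ss;
     b \<leftarrow> sum_t Ss';
     add_t a b })"

section \<open>The FS-2 algorithm\<close>

definition fs2_inner ::
  "crep \<Rightarrow> real list \<Rightarrow> real list \<Rightarrow> real list \<times> real list \<Rightarrow> (real list \<times> real list) timed" where
  "fs2_inner Q u v = (\<lambda>(\<phi>, \<psi>). do {
     a \<leftarrow> mv_transpose_rep Q \<phi>;
     \<psi>' \<leftarrow> zip_with_t div_t v a;
     b \<leftarrow> mv_rep Q \<psi>';
     \<phi>' \<leftarrow> zip_with_t div_t u b;
     return (\<phi>', \<psi>') })"

definition fs2_outer ::
  "crep \<Rightarrow> real list \<Rightarrow> real list \<Rightarrow> nat \<Rightarrow>
   real list \<times> real list \<times> crep \<Rightarrow> (real list \<times> real list \<times> crep) timed" where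
  "fs2_outer K u v L = (\<lambda>(\<phi>, \<psi>, \<Gamma>). do {
     Q \<leftarrow> hadamard_rep K \<Gamma>;
     (\<phi>', \<psi>') \<leftarrow> iterate_t L (fs2_inner Q u v) (\<phi>, \<psi>);
     \<Gamma>' \<leftarrow> scale_rep \<phi>' Q \<psi>';
     return (\<phi>', \<psi>', \<Gamma>') })"

definition fs2_init :: "nat \<Rightarrow> (real list \<times> real list \<times> crep) timed" where
  "fs2_init N = do {
     a \<leftarrow> div_t 1 (real N);
     \<phi> \<leftarrow> fill_t N a;
     \<psi> \<leftarrow> fill_t N a;
     \<Gamma> \<leftarrow> ones_rep N;
     return (\<phi>, \<psi>, \<Gamma>) }"

definition fs2_state ::
  "nat \<Rightarrow> real \<Rightarrow> real \<Rightarrow> real list \<Rightarrow> real list \<Rightarrow> nat \<Rightarrow> nat \<Rightarrow>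
   (real list \<times> real list \<times> crep) timed" where
  "fs2_state N h \<delta> u v L t = do {
     K \<leftarrow> kernel_rep N h \<delta>;
     s \<leftarrow> fs2_init N;
     iterate_t t (fs2_outer K u v L) s }"

definition fs2 ::
  "nat \<Rightarrow> real \<Rightarrow> real \<Rightarrow> real list \<Rightarrow> real list \<Rightarrow> nat \<Rightarrow> nat \<Rightarrow> real timed" where
  "fs2 N h \<delta> u v L itr_max = do {
     (\<phi>, \<psi>, \<Gamma>) \<leftarrow> fs2_state N h \<delta> u v L itr_max;
     transport_cost_rep h \<Gamma> }"

end

theory Submission
  imports Defs
begin

text \<open>A matrix of the class is determined by its diagonal, its superdiagonal and two families of
  recurrences: below the diagonal row \<open>i + 1\<close> is \<open>r\<^sub>i\<close> times row \<open>i\<close>, above it row \<open>i\<close> is \<open>r'\<^sub>i\<close>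
  times row \<open>i + 1\<close>. Entrywise products and diagonal scalings multiply the ratios, so they stay in
  the class, and every row or column sum that the algorithm needs follows from the neighbouring one
  by a bounded number of operations. The cost bounds depend only on the lengths of the lists, hence
  they hold even when a scaling vector has a zero entry, where the representation breaks down.\<close>

section \<open>Timed computations\<close>

text \<open>Quotient conditions are awkward to compute with, so all closure and product arguments
  run on the equivalent multiplicative recurrences of \<open>represents_iff\<close>, where
  nonvanishing of a whole triangle is reduced to nonvanishing ratios, diagonal and superdiagonal
  entries. Two obstacles shape the rest. The class is not closed under transposition, so products
  with the transpose need their own argument: within a column, neighbouring entries on one side of
  the diagonal differ by a factor that depends on the row alone, hence a weighted partial column sum
  is one matrix entry times a number that does not depend on the column. Moreover the upper triangle
  ends early: row \<open>N - 1\<close> has no strictly upper entry, and row \<open>N - 2\<close> has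
  only its superdiagonal entry and no ratio. These two rows are base cases of their own in every
  upward recursion, and for \<open>N = 1\<close> truncated subtraction has to give the right
  lengths. Correctness is a simulation: the lists of FS-2 are the \<open>list_of_vec\<close> images
  of the IPOT vectors, while the representation vectors are tied to the plan by
  \<open>represents\<close>.\<close>

lemma timed_simps [simp]:
  "result (return x) = x" "cost (return x) = 0"
  "result (timed_bind m f) = result (f (result m))"
  "cost (timed_bind m f) = cost m + cost (f (result m))"
  "result tick = ()" "cost tick = 1"
  by (simp_all add: return_def timed_bind_def tick_def)

lemma arith_t_simps [simp]:
  "result (add_t x y) = x + y" "cost (add_t x y) = 1"
  "result (mul_t x y) = x * y" "cost (mul_t x y) = 1"
  "result (div_t x y) = x / y" "cost (div_t x y) = 1"
  "result (neg_t x) = - x" "cost (neg_t x) = 1"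
  "result (exp_t x) = exp x" "cost (exp_t x) = 1"
  by (simp_all add: add_t_def mul_t_def div_t_def neg_t_def exp_t_def)

lemma fill_t_simps [simp]:
  "result (fill_t n x) = replicate n x" "cost (fill_t n x) = Suc n"
  by (induction n) simp_all

lemma result_zip_with_t [simp]:
  "result (zip_with_t f xs ys) = map2 (\<lambda>x y. result (f x y)) xs ys"
  by (induction f xs ys rule: zip_with_t.induct) simp_all

lemma cost_zip_with_t:
  assumes "\<And>x y. cost (f x y) = 1"
  shows "cost (zip_with_t f xs ys) = Suc (2 * min (length xs) (length ys))"
  using assms by (induction f xs ys rule: zip_with_t.induct) simp_all

lemmas cost_zip_with_arith [simp] =
  cost_zip_with_t[of add_t, OF arith_t_simps(2)]
  cost_zip_with_t[of mul_t, OF arith_t_simps(4)]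
  cost_zip_with_t[of div_t, OF arith_t_simps(6)]

lemma sum_t_simps [simp]:
  "result (sum_t xs) = sum_list xs" "cost (sum_t xs) = Suc (2 * length xs)"
  by (induction xs) simp_all

text \<open>The body's cost is bounded only on states satisfying \<open>P\<close>, so invariant and
  bound are proved together; \<open>P\<close> is later instantiated with list lengths. Each round
  pays one tick besides the body, and the base call pays the remaining one.\<close>

lemma iterate_t_invariant:
  assumes "P s" and "\<And>s. P s \<Longrightarrow> P (result (f s)) \<and> cost (f s) \<le> b"
  shows "P (result (iterate_t n f s)) \<and> cost (iterate_t n f s) \<le> Suc (n * Suc b)"
proof (induction n)
  case (Suc n)
  then have "P (result (f (result (iterate_t n f s))))" "cost (f (result (iterate_t n f s))) \<le> b"
    using assms(2) by blast+
  with Suc show ?case by simp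
qed (simp add: assms)

section \<open>Representation by recurrences\<close>

lemma nth_neq_if_notin: "x \<notin> set xs \<Longrightarrow> i < length xs \<Longrightarrow> xs ! i \<noteq> x"
  by auto

text \<open>The corner entries \<open>\<gamma>\<^sub>N\<^sub>-\<^sub>1\<close> and \<open>\<gamma>'\<^sub>0\<close> are never denominators, so they alone may vanish.\<close>

lemma represents_iff:
  "represents N (\<gamma>, \<gamma>', r, r') M \<longleftrightarrow>
     M \<in> carrier_mat N N \<and>
     length \<gamma> = N \<and> length \<gamma>' = N - 1 \<and> length r = N - 1 \<and> length r' = N - 2 \<and>
     0 \<notin> set r \<and> 0 \<notin> set r' \<and>
     (\<forall>i. Suc i < N \<longrightarrow> \<gamma> ! i \<noteq> 0) \<and> (\<forall>i. 0 < i \<and> Suc i < N \<longrightarrow> \<gamma>' ! i \<noteq> 0) \<and>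
     (\<forall>i<N. M $$ (i, i) = \<gamma> ! i) \<and> (\<forall>i. Suc i < N \<longrightarrow> M $$ (i, Suc i) = \<gamma>' ! i) \<and>
     (\<forall>i j. j \<le> i \<and> Suc i < N \<longrightarrow> M $$ (Suc i, j) = r ! i * M $$ (i, j)) \<and>
     (\<forall>i j. Suc i < j \<and> j < N \<longrightarrow> M $$ (i, j) = r' ! i * M $$ (Suc i, j))"
  (is "?L \<longleftrightarrow> ?R")
proof
  assume ?L
  then obtain A B where M: "M = A + B" and A: "lower_collinear N r A"
    and B: "upper_collinear N r' B" and g: "\<gamma> = map (\<lambda>i. A $$ (i, i)) [0..<N]"
    and g': "\<gamma>' = map (\<lambda>i. B $$ (i, i + 1)) [0..<N - 1]"
    by (auto simp: represents_def)
  have cA: "A \<in> carrier_mat N N" and cB: "B \<in> carrier_mat N N"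
    using A B by (auto simp: lower_collinear_def upper_collinear_def)
  have rn: "r ! i \<noteq> 0" if "Suc i < N" for i
    using A nth_neq_if_notin[of 0 r i] that by (simp add: lower_collinear_def)
  have rn': "r' ! i \<noteq> 0" if "Suc (Suc i) < N" for i
    using B nth_neq_if_notin[of 0 r' i] that by (simp add: upper_collinear_def)
  have lo: "M $$ (i, j) = A $$ (i, j)" if "j \<le> i" "i < N" for i j
    using that B cA cB by (auto simp: M upper_collinear_def)
  have up: "M $$ (i, j) = B $$ (i, j)" if "i < j" "j < N" for i j
    using that A cA cB by (auto simp: M lower_collinear_def)
  \<comment> \<open>A zero denominator would make the quotient 0, but it equals a nonzero
    ratio.\<close>
  have Ar: "A $$ (i, j) \<noteq> 0 \<and> A $$ (Suc i, j) = r ! i * A $$ (i, j)" if "j \<le> i" "Suc i < N" for i j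
  proof -
    have "A $$ (Suc i, j) / A $$ (i, j) = r ! i"
      using A that by (auto simp: lower_collinear_def)
    with rn[OF that(2)] show ?thesis by (cases "A $$ (i, j) = 0") (auto simp: field_simps)
  qed
  have Br: "B $$ (Suc i, j) \<noteq> 0 \<and> B $$ (i, j) = r' ! i * B $$ (Suc i, j)"
    if "Suc i < j" "j < N" for i j
  proof -
    have "\<forall>i j. 0 < i \<and> i < j \<and> j < N \<longrightarrow> B $$ (i - 1, j) / B $$ (i, j) = r' ! (i - 1)"
      using B by (simp add: upper_collinear_def)
    from this[rule_format, of "Suc i" j] that have "B $$ (i, j) / B $$ (Suc i, j) = r' ! i"
      by simp
    with rn'[of i] that show ?thesis by (cases "B $$ (Suc i, j) = 0") (auto simp: field_simps)
  qed
  have "\<gamma>' ! i \<noteq> 0" if "0 < i" "Suc i < N" for i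
    using Br[of "i - 1" "Suc i"] that by (simp add: g' less_diff_conv)
  moreover have "M \<in> carrier_mat N N" using cA cB by (simp add: M)
  moreover have "M $$ (Suc i, j) = r ! i * M $$ (i, j)" if "j \<le> i" "Suc i < N" for i j
    using lo[of j i] lo[of j "Suc i"] Ar[OF that] that by simp
  moreover have "M $$ (i, j) = r' ! i * M $$ (Suc i, j)" if "Suc i < j" "j < N" for i j
    using up[of i j] up[of "Suc i" j] Br[OF that] that by simp
  moreover have "length r = N - 1" "length r' = N - 2" "0 \<notin> set r" "0 \<notin> set r'"
    using A B by (simp_all add: lower_collinear_def upper_collinear_def)
  moreover have "\<gamma> ! i \<noteq> 0" if "Suc i < N" for i
    using Ar[of i i] that by (simp add: g)
  moreover have "M $$ (i, i) = \<gamma> ! i" if "i < N" for i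
    using lo[of i i] that by (simp add: g)
  moreover have "M $$ (i, Suc i) = \<gamma>' ! i" if "Suc i < N" for i
    using up[of i "Suc i"] that by (simp add: g' less_diff_conv)
  moreover have "length \<gamma> = N" "length \<gamma>' = N - 1"
    by (simp_all add: g g')
  ultimately show ?R by simp
next
  assume R: ?R
  then have c: "M \<in> carrier_mat N N"
    and l: "length \<gamma> = N" "length \<gamma>' = N - 1" "length r = N - 1" "length r' = N - 2"
    and z: "0 \<notin> set r" "0 \<notin> set r'"
    and gn: "\<And>i. Suc i < N \<Longrightarrow> \<gamma> ! i \<noteq> 0" and gn': "\<And>i. 0 < i \<Longrightarrow> Suc i < N \<Longrightarrow> \<gamma>' ! i \<noteq> 0"
    and d: "\<And>i. i < N \<Longrightarrow> M $$ (i, i) = \<gamma> ! i"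
    and d': "\<And>i. Suc i < N \<Longrightarrow> M $$ (i, Suc i) = \<gamma>' ! i"
    by simp_all
  from R have mr: "M $$ (Suc i, j) = r ! i * M $$ (i, j)" if "j \<le> i" "Suc i < N" for i j
    using that by simp
  from R have mr': "M $$ (i, j) = r' ! i * M $$ (Suc i, j)" if "Suc i < j" "j < N" for i j
    using that by simp
  define A where "A = mat N N (\<lambda>(i, j). if j \<le> i then M $$ (i, j) else 0)"
  define B where "B = mat N N (\<lambda>(i, j). if i < j then M $$ (i, j) else 0)"
  have rn: "r ! i \<noteq> 0" if "Suc i < N" for i
    using nth_neq_if_notin[OF z(1), of i] l that by simp
  have rn': "r' ! i \<noteq> 0" if "Suc (Suc i) < N" for i
    using nth_neq_if_notin[OF z(2), of i] l that by simp
  \<comment> \<open>Nonvanishing spreads down each column from the diagonal, since every factor met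
    on the way is nonzero.\<close>
  have lo: "M $$ (i, j) \<noteq> 0" if "j \<le> i" "Suc i < N" for i j
    using that by (induction i rule: dec_induct) (simp_all add: d gn mr rn)
  \<comment> \<open>Likewise upwards from the superdiagonal. Row 0 is left out: it is never a
    denominator, and its superdiagonal entry may be 0.\<close>
  have up: "M $$ (i, j) \<noteq> 0" if "0 < i" "i < j" "j < N" for i j
  proof -
    from that have "i \<le> j - 1" by simp
    then show ?thesis using that(1)
    proof (induction i rule: inc_induct)
      case base
      then show ?case using d'[of "j - 1"] gn'[of "j - 1"] that by simp
    next
      case (step k)
      then show ?case using mr'[of k j] rn'[of k] that by simp
    qed
  qed
  have "lower_collinear N r A"
    using l z lo by (auto simp: lower_collinear_def A_def mr)
  moreover have "upper_collinear N r' B"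
  proof -
    have "M $$ (i - 1, j) / M $$ (i, j) = r' ! (i - 1)" if "0 < i" "i < j" "j < N" for i j
      using mr'[of "i - 1" j] up[OF that] that by simp
    then show ?thesis using l z by (auto simp: upper_collinear_def B_def)
  qed
  moreover have "M = A + B"
    using c by (intro eq_matI) (auto simp: A_def B_def)
  moreover have "\<gamma> = map (\<lambda>i. A $$ (i, i)) [0..<N]"
    using l d by (intro nth_equalityI) (auto simp: A_def)
  moreover have "\<gamma>' = map (\<lambda>i. B $$ (i, i + 1)) [0..<N - 1]"
    using l d' by (intro nth_equalityI) (auto simp: B_def less_diff_conv)
  ultimately show ?L by (auto simp: represents_def)
qed

lemma representsE:
  assumes "represents N \<rho> M"
  obtains \<gamma> \<gamma>' r r' where "\<rho> = (\<gamma>, \<gamma>', r, r')" "M \<in> carrier_mat N N"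
    "length \<gamma> = N" "length \<gamma>' = N - 1" "length r = N - 1" "length r' = N - 2"
    "\<And>i. i < N \<Longrightarrow> M $$ (i, i) = \<gamma> ! i" "\<And>i. Suc i < N \<Longrightarrow> M $$ (i, Suc i) = \<gamma>' ! i"
    "\<And>i j. j \<le> i \<Longrightarrow> Suc i < N \<Longrightarrow> M $$ (Suc i, j) = r ! i * M $$ (i, j)"
    "\<And>i j. Suc i < j \<Longrightarrow> j < N \<Longrightarrow> M $$ (i, j) = r' ! i * M $$ (Suc i, j)"
proof -
  obtain \<gamma> \<gamma>' r r' where \<rho>: "\<rho> = (\<gamma>, \<gamma>', r, r')" by (cases \<rho>)
  show thesis
    by (rule that[OF \<rho>]) (use assms[unfolded \<rho> represents_iff] in simp_all)
qed

lemma represents_C_mats: "represents N \<rho> M \<Longrightarrow> M \<in> C_mats N"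
  by (cases \<rho>) (auto simp: represents_def C_mats_def C_L_def C_U_def)

text \<open>The diagonal and superdiagonal start each column and the ratios continue it away from
  the diagonal. This makes precise that the four vectors suffice to describe a matrix.\<close>

lemma represents_unique:
  assumes "represents N \<rho> M" "represents N \<rho> M'"
  shows "M = M'"
  using assms(1)
proof (rule representsE)
  fix \<gamma> \<gamma>' r r'
  assume \<rho>: "\<rho> = (\<gamma>, \<gamma>', r, r')" and c: "M \<in> carrier_mat N N"
    and d: "\<And>i. i < N \<Longrightarrow> M $$ (i, i) = \<gamma> ! i"
    and d': "\<And>i. Suc i < N \<Longrightarrow> M $$ (i, Suc i) = \<gamma>' ! i"
    and r: "\<And>i j. j \<le> i \<Longrightarrow> Suc i < N \<Longrightarrow> M $$ (Suc i, j) = r ! i * M $$ (i, j)"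
    and r': "\<And>i j. Suc i < j \<Longrightarrow> j < N \<Longrightarrow> M $$ (i, j) = r' ! i * M $$ (Suc i, j)"
  have M': "M' \<in> carrier_mat N N" "\<And>i. i < N \<Longrightarrow> M' $$ (i, i) = \<gamma> ! i"
    "\<And>i. Suc i < N \<Longrightarrow> M' $$ (i, Suc i) = \<gamma>' ! i"
    "\<And>i j. j \<le> i \<Longrightarrow> Suc i < N \<Longrightarrow> M' $$ (Suc i, j) = r ! i * M' $$ (i, j)"
    "\<And>i j. Suc i < j \<Longrightarrow> j < N \<Longrightarrow> M' $$ (i, j) = r' ! i * M' $$ (Suc i, j)"
    using assms(2) by (auto simp: \<rho> represents_iff)
  have lo: "M $$ (i, j) = M' $$ (i, j)" if "j \<le> i" "i < N" for i j
    using that by (induction i rule: dec_induct) (simp_all add: d M'(2) r M'(4))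
  have up: "M $$ (i, j) = M' $$ (i, j)" if "i < j" "j < N" for i j
  proof -
    from that(1) have "i \<le> j - 1" by simp
    then show ?thesis
    proof (induction i rule: inc_induct)
      case base
      from that show ?case using d'[of "j - 1"] M'(3)[of "j - 1"] by simp
    next
      case (step k)
      then show ?case using r'[of k j] M'(5)[of k j] that by simp
    qed
  qed
  show ?thesis
    using c M'(1) lo up by (intro eq_matI) (auto simp: not_le[symmetric])
qed

lemma representsI:
  assumes "M \<in> carrier_mat N N"
    "length \<gamma> = N" "length \<gamma>' = N - 1" "length r = N - 1" "length r' = N - 2"
    "\<And>i. Suc i < N \<Longrightarrow> r ! i \<noteq> 0" "\<And>i. Suc (Suc i) < N \<Longrightarrow> r' ! i \<noteq> 0"
    "\<And>i. Suc i < N \<Longrightarrow> \<gamma> ! i \<noteq> 0" "\<And>i. 0 < i \<Longrightarrow> Suc i < N \<Longrightarrow> \<gamma>' ! i \<noteq> 0"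
    "\<And>i. i < N \<Longrightarrow> M $$ (i, i) = \<gamma> ! i" "\<And>i. Suc i < N \<Longrightarrow> M $$ (i, Suc i) = \<gamma>' ! i"
    "\<And>i j. j \<le> i \<Longrightarrow> Suc i < N \<Longrightarrow> M $$ (Suc i, j) = r ! i * M $$ (i, j)"
    "\<And>i j. Suc i < j \<Longrightarrow> j < N \<Longrightarrow> M $$ (i, j) = r' ! i * M $$ (Suc i, j)"
  shows "represents N (\<gamma>, \<gamma>', r, r') M"
proof -
  have "0 \<notin> set r" "0 \<notin> set r'"
    using assms(4-7) by (auto simp: in_set_conv_nth)
  then show ?thesis
    unfolding represents_iff using assms(1-5,8-) by simp
qed

section \<open>Membership of the initial matrices and closure under Hadamard product and
  scaling\<close>

lemma represents_ones: "represents N (result (ones_rep N)) (ones_mat N)"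
  by (simp add: ones_rep_def, rule representsI) (simp_all add: ones_mat_def)

text \<open>The exponent is linear in the distance from the diagonal, so one step away from the
  diagonal multiplies an entry by \<open>exp (- h / \<delta>)\<close>; all ratios are this one
  number.\<close>

lemma represents_kernel: "represents N (result (kernel_rep N h \<delta>)) (kernel_mat N h \<delta>)"
proof -
  let ?K = "kernel_mat N h \<delta>"
  have K: "?K $$ (i, j) = exp (- h / \<delta> * \<bar>real i - real j\<bar>)" if "i < N" "j < N" for i j
    using that by (simp add: kernel_mat_def cost_mat_def)
  have "?K $$ (Suc i, j) = exp (- h / \<delta>) * ?K $$ (i, j)" if "j \<le> i" "Suc i < N" for i j
  proof -
    have "\<bar>real (Suc i) - real j\<bar> = 1 + \<bar>real i - real j\<bar>" using that by simp
    then show ?thesis using that by (simp only: K distrib_left exp_add mult_1_right)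
  qed
  moreover have "?K $$ (i, j) = exp (- h / \<delta>) * ?K $$ (Suc i, j)" if "Suc i < j" "j < N" for i j
  proof -
    have "\<bar>real i - real j\<bar> = 1 + \<bar>real (Suc i) - real j\<bar>" using that by simp
    then show ?thesis using that by (simp only: K distrib_left exp_add mult_1_right)
  qed
  moreover have "?K \<in> carrier_mat N N" by (simp add: kernel_mat_def cost_mat_def)
  ultimately show ?thesis
    by (simp add: kernel_rep_def, intro representsI) (simp_all add: K)
qed

lemma represents_nonzero:
  assumes "represents N (\<gamma>, \<gamma>', r, r') M"
  shows "\<And>i. Suc i < N \<Longrightarrow> r ! i \<noteq> 0" "\<And>i. Suc (Suc i) < N \<Longrightarrow> r' ! i \<noteq> 0"
    "\<And>i. Suc i < N \<Longrightarrow> \<gamma> ! i \<noteq> 0" "\<And>i. 0 < i \<Longrightarrow> Suc i < N \<Longrightarrow> \<gamma>' ! i \<noteq> 0"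
proof -
  have l: "length r = N - 1" "length r' = N - 2" and z: "0 \<notin> set r" "0 \<notin> set r'"
    using assms by (simp_all add: represents_iff)
  show "r ! i \<noteq> 0" if "Suc i < N" for i
    using nth_neq_if_notin[OF z(1), of i] l that by simp
  show "r' ! i \<noteq> 0" if "Suc (Suc i) < N" for i
    using nth_neq_if_notin[OF z(2), of i] l that by simp
qed (use assms in \<open>simp_all add: represents_iff\<close>)

lemma represents_hadamard:
  assumes "represents N \<rho>1 M1" "represents N \<rho>2 M2"
  shows "represents N (result (hadamard_rep \<rho>1 \<rho>2)) (M1 \<odot>\<^sub>m M2)"
  using assms(1)
proof (rule representsE)
  fix \<gamma>1 \<gamma>1' r1 r1'
  assume 1: "\<rho>1 = (\<gamma>1, \<gamma>1', r1, r1')" "M1 \<in> carrier_mat N N"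
    "length \<gamma>1 = N" "length \<gamma>1' = N - 1" "length r1 = N - 1" "length r1' = N - 2"
    "\<And>i. i < N \<Longrightarrow> M1 $$ (i, i) = \<gamma>1 ! i" "\<And>i. Suc i < N \<Longrightarrow> M1 $$ (i, Suc i) = \<gamma>1' ! i"
    "\<And>i j. j \<le> i \<Longrightarrow> Suc i < N \<Longrightarrow> M1 $$ (Suc i, j) = r1 ! i * M1 $$ (i, j)"
    "\<And>i j. Suc i < j \<Longrightarrow> j < N \<Longrightarrow> M1 $$ (i, j) = r1' ! i * M1 $$ (Suc i, j)"
  from assms(2) obtain \<gamma>2 \<gamma>2' r2 r2'
    where 2: "\<rho>2 = (\<gamma>2, \<gamma>2', r2, r2')" "M2 \<in> carrier_mat N N"
      "length \<gamma>2 = N" "length \<gamma>2' = N - 1" "length r2 = N - 1" "length r2' = N - 2"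
      "\<And>i. i < N \<Longrightarrow> M2 $$ (i, i) = \<gamma>2 ! i" "\<And>i. Suc i < N \<Longrightarrow> M2 $$ (i, Suc i) = \<gamma>2' ! i"
      "\<And>i j. j \<le> i \<Longrightarrow> Suc i < N \<Longrightarrow> M2 $$ (Suc i, j) = r2 ! i * M2 $$ (i, j)"
      "\<And>i j. Suc i < j \<Longrightarrow> j < N \<Longrightarrow> M2 $$ (i, j) = r2' ! i * M2 $$ (Suc i, j)"
    by (rule representsE) blast
  note nz = represents_nonzero[OF assms(1)[unfolded 1(1)]]
    represents_nonzero[OF assms(2)[unfolded 2(1)]]
  have up: "(M1 \<odot>\<^sub>m M2) $$ (i, j) = r1' ! i * r2' ! i * (M1 \<odot>\<^sub>m M2) $$ (Suc i, j)"
    if "Suc i < j" "j < N" for i j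
    using that 1(2) by (simp add: hadamard_def 1(10)[OF that] 2(10)[OF that])
  show ?thesis
    by (simp add: hadamard_rep_def 1(1) 2(1), rule representsI)
      (use 1(2-9) 2(2-9) nz in \<open>simp_all add: up, simp_all add: hadamard_def\<close>)
qed

lemma diag_scale_eq:
  assumes "M \<in> carrier_mat N N" "x \<in> carrier_vec N" "y \<in> carrier_vec N"
  shows "diag_of x * M * diag_of y = mat N N (\<lambda>(i, j). x $ i * M $$ (i, j) * y $ j)"
proof -
  have d: "dim_vec x = N" "dim_vec y = N"
    using assms by auto
  show ?thesis
    unfolding diag_of_def d mat_diag_mult_left[OF assms(1)]
    by (subst mat_diag_mult_right[where nr = N]) auto
qed

text \<open>The factor from \<psi> is constant along a column and cancels from the ratios, which
  therefore change by quotients of \<phi> alone. Nonzero \<phi> keeps the ratios nonzero; both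
  vectors together keep the diagonal and superdiagonal entries nonzero where this is
  required.\<close>

lemma represents_scale:
  assumes "represents N \<rho> Q" "nonzero_vec N \<phi>" "nonzero_vec N \<psi>"
  shows "represents N (result (scale_rep (list_of_vec \<phi>) \<rho> (list_of_vec \<psi>)))
    (diag_of \<phi> * Q * diag_of \<psi>)"
  using assms(1)
proof (rule representsE)
  fix \<gamma> \<gamma>' r r'
  assume Q: "\<rho> = (\<gamma>, \<gamma>', r, r')" "Q \<in> carrier_mat N N"
    "length \<gamma> = N" "length \<gamma>' = N - 1" "length r = N - 1" "length r' = N - 2"
    "\<And>i. i < N \<Longrightarrow> Q $$ (i, i) = \<gamma> ! i" "\<And>i. Suc i < N \<Longrightarrow> Q $$ (i, Suc i) = \<gamma>' ! i"
    "\<And>i j. j \<le> i \<Longrightarrow> Suc i < N \<Longrightarrow> Q $$ (Suc i, j) = r ! i * Q $$ (i, j)"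
    "\<And>i j. Suc i < j \<Longrightarrow> j < N \<Longrightarrow> Q $$ (i, j) = r' ! i * Q $$ (Suc i, j)"
  note nz = represents_nonzero[OF assms(1)[unfolded Q(1)]]
  have c: "\<phi> \<in> carrier_vec N" "\<psi> \<in> carrier_vec N"
    and nz': "\<And>i. i < N \<Longrightarrow> \<phi> $ i \<noteq> 0" "\<And>i. i < N \<Longrightarrow> \<psi> $ i \<noteq> 0"
    using assms(2,3) by (auto simp: nonzero_vec_def)
  let ?S = "mat N N (\<lambda>(i, j). \<phi> $ i * Q $$ (i, j) * \<psi> $ j)"
  have up: "?S $$ (i, j) = r' ! i / (\<phi> $ Suc i / \<phi> $ i) * ?S $$ (Suc i, j)"
    if "Suc i < j" "j < N" for i j
    using that nz'(1)[of "Suc i"] by (simp add: Q(10)[OF that])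
  show ?thesis
    unfolding diag_scale_eq[OF Q(2) c]
    by (simp add: scale_rep_def Q(1), rule representsI)
      (use Q(2-9) c nz nz' in \<open>simp_all add: up list_of_vec_index nth_tl del: index_mat\<close>, simp_all)
qed

section \<open>Matrix-vector products and transport cost\<close>

text \<open>Prepending the carried value \<open>p\<close> turns index \<open>i\<close> of the longer
  list into the predecessor of entry \<open>i\<close>, so one formula covers the first step and all
  later ones. The same device serves \<open>forward_from\<close> and
  \<open>lower_rows_from\<close>.\<close>

lemma lower_mv_from_correct:
  assumes "length rs = length gs" "length ys = length gs"
  shows "length (result (lower_mv_from p rs gs ys)) = length gs"
    "i < length gs \<Longrightarrow> result (lower_mv_from p rs gs ys) ! i =
       rs ! i * (p # result (lower_mv_from p rs gs ys)) ! i + gs ! i * ys ! i"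
  using assms
proof (induction p rs gs ys arbitrary: i rule: lower_mv_from.induct)
  case (1 p r rs g gs y ys)
  {
    case 1
    then show ?case using "1.IH"(1) by simp
  next
    case 2
    then show ?case using "1.IH"(2)[of "i - 1"] by (cases i) simp_all
  }
qed simp_all

lemma lower_mv_correct:
  assumes "length rs = length gs - 1" "length ys = length gs"
  shows "length (result (lower_mv gs rs ys)) = length gs"
    "0 < length gs \<Longrightarrow> result (lower_mv gs rs ys) ! 0 = gs ! 0 * ys ! 0"
    "Suc i < length gs \<Longrightarrow> result (lower_mv gs rs ys) ! Suc i =
       rs ! i * result (lower_mv gs rs ys) ! i + gs ! Suc i * ys ! Suc i"
  using assms
  by (cases gs; cases ys; simp add: lower_mv_from_correct)+

text \<open>The last superdiagonal row has no ratio, so its value is a separate clause, guarded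
  because \<open>gs\<close> is empty for \<open>N = 1\<close>. The additional final entry 0 belongs
  to the last row.\<close>

lemma upper_mv_correct:
  assumes "length rs = length gs - 1" "length ys = length gs"
  shows "length (result (upper_mv gs rs ys)) = Suc (length gs) \<and>
    result (upper_mv gs rs ys) ! length gs = 0 \<and>
    (\<forall>i. Suc i < length gs \<longrightarrow> result (upper_mv gs rs ys) ! i =
       rs ! i * result (upper_mv gs rs ys) ! Suc i + gs ! i * ys ! i) \<and>
    (gs \<noteq> [] \<longrightarrow> result (upper_mv gs rs ys) ! (length gs - 1) = last gs * last ys)"
  using assms
proof (induction gs rs ys rule: upper_mv.induct)
  case (1 g gs r rs y ys)
  have l: "length rs = length gs - 1" "length ys = length gs" "gs \<noteq> []" "ys \<noteq> []"
    using "1.prems" by auto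
  have IH: "length (result (upper_mv gs rs ys)) = Suc (length gs)"
    "result (upper_mv gs rs ys) ! length gs = 0"
    "\<forall>i. Suc i < length gs \<longrightarrow> result (upper_mv gs rs ys) ! i =
       rs ! i * result (upper_mv gs rs ys) ! Suc i + gs ! i * ys ! i"
    "result (upper_mv gs rs ys) ! (length gs - 1) = last gs * last ys"
    using "1.IH"[OF l(1,2)] l(3) by auto
  have "result (upper_mv gs rs ys) \<noteq> []" using IH(1) by auto
  then show ?case
    using IH l by (auto simp: nth_Cons hd_conv_nth split: nat.splits)
qed auto

lemma backward_t_correct:
  assumes "length ys = Suc (length rs)"
  shows "length (result (backward_t rs ys)) = length ys \<and>
    result (backward_t rs ys) ! length rs = ys ! length rs \<and>
    (\<forall>i<length rs. result (backward_t rs ys) ! i =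
      ys ! i + rs ! i * result (backward_t rs ys) ! Suc i)"
  using assms
proof (induction rs ys rule: backward_t.induct)
  case (1 r rs y ys)
  then have l: "length ys = Suc (length rs)" by simp
  note IH = "1.IH"[OF l]
  have "hd (result (backward_t rs ys)) = result (backward_t rs ys) ! 0"
    using IH[THEN conjunct1] l by (intro hd_conv_nth) auto
  then show ?case
    using IH by (simp only: backward_t.simps timed_simps arith_t_simps All_less_Suc2 list.size
        add_Suc_right add_0_right nth_Cons_0 nth_Cons_Suc simp_thms) blast
qed auto

lemma forward_from_correct:
  assumes "length rs \<le> length ys"
  shows "length (result (forward_from w rs ys)) = length rs"
    "i < length rs \<Longrightarrow> result (forward_from w rs ys) ! i =
       rs ! i * (w # result (forward_from w rs ys)) ! i + ys ! i"
  using assms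
proof (induction w rs ys arbitrary: i rule: forward_from.induct)
  case (1 w r rs y ys)
  {
    case 1
    then show ?case using "1.IH"(1) by simp
  next
    case 2
    then show ?case using "1.IH"(2)[of "i - 1"] by (cases i) simp_all
  }
qed simp_all

lemma forward_t_correct:
  assumes "length rs < length ys"
  shows "length (result (forward_t rs ys)) = Suc (length rs)"
    "result (forward_t rs ys) ! 0 = ys ! 0"
    "i < length rs \<Longrightarrow> result (forward_t rs ys) ! Suc i =
       rs ! i * result (forward_t rs ys) ! i + ys ! Suc i"
  using assms by (cases ys; simp add: forward_from_correct)+

text \<open>Only the weighted sums are output; the plain row sums stay in an accumulator. The list
  \<open>Ts\<close> restores them so that the coupled recurrences can be stated.\<close>

lemma lower_rows_from_correct:
  assumes "length rs = length gs"
  shows "\<exists>Ts. length (result (lower_rows_from h S T rs gs)) = length gs \<and> length Ts = length gs \<and>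
    (\<forall>i<length gs. result (lower_rows_from h S T rs gs) ! i =
       rs ! i * ((S # result (lower_rows_from h S T rs gs)) ! i + h * (T # Ts) ! i) \<and>
     Ts ! i = rs ! i * (T # Ts) ! i + gs ! i)"
  using assms
proof (induction h S T rs gs rule: lower_rows_from.induct)
  case (1 h S T r rs g gs)
  let ?S = "r * (S + h * T)" and ?T = "r * T + g"
  have "\<exists>Ts. length (result (lower_rows_from h ?S ?T rs gs)) = length gs \<and> length Ts = length gs \<and>
    (\<forall>i<length gs. result (lower_rows_from h ?S ?T rs gs) ! i =
       rs ! i * ((?S # result (lower_rows_from h ?S ?T rs gs)) ! i + h * (?T # Ts) ! i) \<and>
     Ts ! i = rs ! i * (?T # Ts) ! i + gs ! i)"
    using 1 by simp
  then obtain Ts where Ts: "length (result (lower_rows_from h ?S ?T rs gs)) = length gs"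
    "length Ts = length gs"
    "\<forall>i<length gs. result (lower_rows_from h ?S ?T rs gs) ! i =
       rs ! i * ((?S # result (lower_rows_from h ?S ?T rs gs)) ! i + h * (?T # Ts) ! i) \<and>
     Ts ! i = rs ! i * (?T # Ts) ! i + gs ! i" by blast
  show ?case
    by (rule exI[of _ "?T # Ts"]) (use Ts in \<open>simp add: All_less_Suc2\<close>)
qed simp_all

lemma lower_rows_correct:
  assumes "length rs = length gs - 1" "gs \<noteq> []"
  shows "\<exists>Ts. length (result (lower_rows h gs rs)) = length gs \<and> length Ts = length gs \<and>
    result (lower_rows h gs rs) ! 0 = 0 \<and> Ts ! 0 = gs ! 0 \<and>
    (\<forall>i. Suc i < length gs \<longrightarrow>
       result (lower_rows h gs rs) ! Suc i =
         rs ! i * (result (lower_rows h gs rs) ! i + h * Ts ! i) \<and>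
       Ts ! Suc i = rs ! i * Ts ! i + gs ! Suc i)"
proof (cases gs)
  case (Cons g gs')
  from assms(1) Cons have "length rs = length gs'" by simp
  from lower_rows_from_correct[OF this, of h 0 g] obtain Ts where
    "length (result (lower_rows_from h 0 g rs gs')) = length gs'" "length Ts = length gs'"
    "\<forall>i<length gs'. result (lower_rows_from h 0 g rs gs') ! i =
       rs ! i * ((0 # result (lower_rows_from h 0 g rs gs')) ! i + h * (g # Ts) ! i) \<and>
     Ts ! i = rs ! i * (g # Ts) ! i + gs' ! i"
    by blast
  then show ?thesis
    by (intro exI[of _ "g # Ts"]) (simp add: Cons)
qed (use assms in simp)

text \<open>The function hands on only the topmost plain row sum. \<open>Ts\<close> records all of
  them, and the clause for \<open>Ts ! 0\<close> ties the list to the returned value, which the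
  induction step consumes.\<close>

lemma upper_rows_correct:
  assumes "length rs = length gs - 1"
  shows "\<exists>Ts. length (fst (result (upper_rows h gs rs))) = Suc (length gs) \<and>
    length Ts = Suc (length gs) \<and> Ts ! 0 = snd (result (upper_rows h gs rs)) \<and>
    fst (result (upper_rows h gs rs)) ! length gs = 0 \<and>
    (gs \<noteq> [] \<longrightarrow> fst (result (upper_rows h gs rs)) ! (length gs - 1) = h * last gs \<and>
       Ts ! (length gs - 1) = last gs) \<and>
    (\<forall>i. Suc i < length gs \<longrightarrow>
       fst (result (upper_rows h gs rs)) ! i =
         h * gs ! i + rs ! i * (fst (result (upper_rows h gs rs)) ! Suc i + h * Ts ! Suc i) \<and>
       Ts ! i = gs ! i + rs ! i * Ts ! Suc i)"
  using assms
proof (induction h gs rs rule: upper_rows.induct)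
  case (1 h g gs r rs)
  then have l: "length rs = length gs - 1" "gs \<noteq> []" by auto
  let ?U = "result (upper_rows h gs rs)"
  from "1.IH"[OF l(1)] obtain Ts where Ts: "length (fst ?U) = Suc (length gs)"
    "length Ts = Suc (length gs)" "Ts ! 0 = snd ?U" "fst ?U ! length gs = 0"
    "fst ?U ! (length gs - 1) = h * last gs" "Ts ! (length gs - 1) = last gs"
    "\<And>i. Suc i < length gs \<Longrightarrow>
       fst ?U ! i = h * gs ! i + rs ! i * (fst ?U ! Suc i + h * Ts ! Suc i)"
    "\<And>i. Suc i < length gs \<Longrightarrow> Ts ! i = gs ! i + rs ! i * Ts ! Suc i"
    using l(2) by auto
  have "fst ?U \<noteq> []" using Ts(1) by auto
  then show ?case
    by (intro exI[of _ "(g + r * snd ?U) # Ts"])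
      (use Ts l in \<open>auto simp: nth_Cons hd_conv_nth split_beta split: nat.splits\<close>)
next
  case (2 h g gs)
  \<comment> \<open>The 0 stands for the last row, whose strictly upper part is empty.\<close>
  then show ?case by (intro exI[of _ "[g, 0]"]) auto
next
  case (3 h rs)
  then show ?case by (intro exI[of _ "[0]"]) auto
qed

section \<open>From list recurrences to sums over rows and columns\<close>

lemma sum_split_at:
  fixes f :: "nat \<Rightarrow> real"
  assumes "i < N"
  shows "(\<Sum>j<N. f j) = (\<Sum>j\<le>i. f j) + (\<Sum>j=Suc i..<N. f j)"
proof -
  have "{..<N} = {..i} \<union> {Suc i..<N}" "{..i} \<inter> {Suc i..<N} = {}" using assms by auto
  then show ?thesis by (simp add: sum.union_disjoint)
qed

text \<open>Counterpart of \<open>sum_split_at\<close> for columns: there the diagonal entry belongs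
  to the tail of the sum, in rows to its head.\<close>

lemma sum_split_before:
  fixes f :: "nat \<Rightarrow> real"
  assumes "i < N"
  shows "(\<Sum>j<N. f j) = (\<Sum>j<i. f j) + (\<Sum>j=i..<N. f j)"
proof -
  have "{..<N} = {..<i} \<union> {i..<N}" "{..<i} \<inter> {i..<N} = {}" using assms by auto
  then show ?thesis by (simp add: sum.union_disjoint)
qed

lemma mv_rep_index:
  assumes "represents N \<rho> Q" "length y = N" "0 < N"
  shows "length (result (mv_rep \<rho> y)) = N"
    "i < N \<Longrightarrow> result (mv_rep \<rho> y) ! i = (\<Sum>j<N. Q $$ (i, j) * y ! j)"
proof -
  from assms(1) obtain \<gamma> \<gamma>' r r'
    where Q: "\<rho> = (\<gamma>, \<gamma>', r, r')" "Q \<in> carrier_mat N N"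
      "length \<gamma> = N" "length \<gamma>' = N - 1" "length r = N - 1" "length r' = N - 2"
      "\<And>i. i < N \<Longrightarrow> Q $$ (i, i) = \<gamma> ! i" "\<And>i. Suc i < N \<Longrightarrow> Q $$ (i, Suc i) = \<gamma>' ! i"
      "\<And>i j. j \<le> i \<Longrightarrow> Suc i < N \<Longrightarrow> Q $$ (Suc i, j) = r ! i * Q $$ (i, j)"
      "\<And>i j. Suc i < j \<Longrightarrow> j < N \<Longrightarrow> Q $$ (i, j) = r' ! i * Q $$ (Suc i, j)"
    by (rule representsE) blast
  define p where "p = result (lower_mv \<gamma> r y)"
  define q where "q = result (upper_mv \<gamma>' r' (tl y))"
  have l: "length r = length \<gamma> - 1" "length y = length \<gamma>"
    "length r' = length \<gamma>' - 1" "length (tl y) = length \<gamma>'"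
    using Q assms(2) by auto
  note P = lower_mv_correct[OF l(1,2), folded p_def, unfolded Q(3)]
  from upper_mv_correct[OF l(3,4), folded q_def, unfolded Q(4)]
  have U: "length q = Suc (N - 1)" "q ! (N - 1) = 0"
    "\<gamma>' \<noteq> [] \<Longrightarrow> q ! (N - 1 - 1) = last \<gamma>' * last (tl y)"
    and U_step: "\<And>i. Suc i < N - 1 \<Longrightarrow> q ! i = r' ! i * q ! Suc i + \<gamma>' ! i * tl y ! i"
    by blast+
  \<comment> \<open>Up to column \<open>i\<close>, row \<open>i + 1\<close> is \<open>r ! i\<close>
    times row \<open>i\<close>, so the old sum is rescaled and only the diagonal term is
    new.\<close>
  have p: "p ! i = (\<Sum>j\<le>i. Q $$ (i, j) * y ! j)" if "i < N" for i
    using that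
  proof (induction i)
    case 0
    then show ?case using P(2) Q(7)[of 0] by simp
  next
    case (Suc i)
    then have "p ! Suc i = r ! i * (\<Sum>j\<le>i. Q $$ (i, j) * y ! j) + \<gamma> ! Suc i * y ! Suc i"
      using P(3)[of i] by simp
    also have "r ! i * (\<Sum>j\<le>i. Q $$ (i, j) * y ! j) = (\<Sum>j\<le>i. Q $$ (Suc i, j) * y ! j)"
      using Suc.prems by (simp add: sum_distrib_left Q(9) mult.assoc)
    finally show ?case using Suc.prems Q(7)[of "Suc i"] by simp
  qed
  \<comment> \<open>Decreasing induction from the empty sum in the last row.\<close>
  have q: "q ! i = (\<Sum>j=Suc i..<N. Q $$ (i, j) * y ! j)" if "i < N" for i
  proof -
    from that have "i \<le> N - 1" by simp
    then show ?thesis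
    proof (induction i rule: inc_induct)
      case base
      then show ?case using U(2) assms(3) by simp
    next
      case (step i)
      then have i: "Suc i < N" by simp
      \<comment> \<open>The superdiagonal entry of row \<open>i\<close> meets component
        \<open>i + 1\<close> of \<open>y\<close>, hence the shift by \<open>tl\<close>.\<close>
      have y: "tl y ! i = y ! Suc i"
        using i Q(4) l(4) by (intro nth_tl) simp
      show ?case
      proof (cases "Suc (Suc i) < N")
        case True
        have "q ! i = r' ! i * q ! Suc i + \<gamma>' ! i * tl y ! i"
          using U_step[of i] True by simp
        also have "r' ! i * q ! Suc i = (\<Sum>j=Suc (Suc i)..<N. Q $$ (i, j) * y ! j)"
          by (simp add: step.IH sum_distrib_left Q(10) mult.assoc)
        also have "\<gamma>' ! i * tl y ! i = Q $$ (i, Suc i) * y ! Suc i"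
          using i Q(8) by (simp add: y)
        finally show ?thesis using i by (simp add: sum.atLeast_Suc_lessThan[of "Suc i"])
      next
        case False
        \<comment> \<open>Row \<open>N - 2\<close> has no ratio; its sum is the single superdiagonal
          term.\<close>
        with i have N: "N = Suc (Suc i)" by simp
        have len: "length \<gamma>' = Suc i" "length (tl y) = Suc i" using Q(4) l(4) N by simp_all
        then have "\<gamma>' \<noteq> []" "tl y \<noteq> []" by (auto simp del: length_tl)
        then have "q ! i = \<gamma>' ! i * tl y ! i"
          using U(3) len by (simp add: N last_conv_nth del: length_tl)
        then show ?thesis using Q(8)[of i] y by (simp add: N)
      qed
    qed
  qed
  have R: "result (mv_rep \<rho> y) = map2 (+) p q"
    by (simp add: mv_rep_def Q(1) p_def q_def)
  show "length (result (mv_rep \<rho> y)) = N"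
    using P(1) U(1) assms(3) by (simp add: R)
  show "result (mv_rep \<rho> y) ! i = (\<Sum>j<N. Q $$ (i, j) * y ! j)" if "i < N"
    using P(1) U(1) assms(3) that by (simp add: R p q sum_split_at[OF that])
qed

text \<open>Each column is cut at the diagonal. Both pieces factor into a matrix entry and a weight
  shared by all columns, and the two weights are what the backward and forward recursions
  compute.\<close>

lemma mv_transpose_rep_index:
  assumes "represents N \<rho> Q" "length y = N" "0 < N"
  shows "length (result (mv_transpose_rep \<rho> y)) = N"
    "j < N \<Longrightarrow> result (mv_transpose_rep \<rho> y) ! j = (\<Sum>i<N. Q $$ (i, j) * y ! i)"
proof -
  from assms(1) obtain \<gamma> \<gamma>' r r'
    where Q: "\<rho> = (\<gamma>, \<gamma>', r, r')" "Q \<in> carrier_mat N N"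
      "length \<gamma> = N" "length \<gamma>' = N - 1" "length r = N - 1" "length r' = N - 2"
      "\<And>i. i < N \<Longrightarrow> Q $$ (i, i) = \<gamma> ! i" "\<And>i. Suc i < N \<Longrightarrow> Q $$ (i, Suc i) = \<gamma>' ! i"
      "\<And>i j. j \<le> i \<Longrightarrow> Suc i < N \<Longrightarrow> Q $$ (Suc i, j) = r ! i * Q $$ (i, j)"
      "\<And>i j. Suc i < j \<Longrightarrow> j < N \<Longrightarrow> Q $$ (i, j) = r' ! i * Q $$ (Suc i, j)"
    by (rule representsE) blast
  define s where "s = result (backward_t r y)"
  define w where "w = result (forward_t r' y)"
  have l: "length y = Suc (length r)" "length r' < length y"
    using Q assms(2,3) by auto
  from backward_t_correct[OF l(1), folded s_def, unfolded assms(2) Q(5)]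
  have S: "length s = N" "s ! (N - 1) = y ! (N - 1)"
    and S_step: "\<And>i. i < N - 1 \<Longrightarrow> s ! i = y ! i + r ! i * s ! Suc i"
    by blast+
  note W = forward_t_correct[OF l(2), folded w_def, unfolded Q(6)]
  \<comment> \<open>All columns \<open>j \<le> k\<close> continue below row \<open>k\<close> with
    the same factors \<open>r\<close>, so \<open>Q $$ (k, j)\<close> can be pulled out and the rest,
    \<open>s ! k\<close>, is free of \<open>j\<close>. The induction starts at the last row, where
    the tail is one entry.\<close>
  have s: "(\<Sum>i=k..<N. Q $$ (i, j) * y ! i) = Q $$ (k, j) * s ! k" if "j \<le> k" "k < N" for j k
  proof -
    from that have "k \<le> N - 1" by simp
    then show ?thesis using that(1)
    proof (induction k rule: inc_induct)
      case base
      have "{N - 1..<N} = {N - 1}" using assms(3) by auto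
      then show ?case using S(2) by simp
    next
      case (step k)
      then have "s ! k = y ! k + r ! k * s ! Suc k" using S_step by blast
      then show ?case
        using step Q(9)[of j k] by (simp add: sum.atLeast_Suc_lessThan algebra_simps)
    qed
  qed
  \<comment> \<open>The mirror image above the diagonal: the ratios express each row by the next
    one, so the entry pulled out is the lowest of the piece.\<close>
  have w: "(\<Sum>i\<le>k. Q $$ (i, j) * y ! i) = Q $$ (k, j) * w ! k" if "k < j" "j < N" for j k
    using that(1)
  proof (induction k)
    case 0
    then show ?case using W(2) by simp
  next
    case (Suc k)
    then have "w ! Suc k = r' ! k * w ! k + y ! Suc k" using W(3)[of k] that(2) by simp
    then show ?case using Suc Q(10)[of k j] that(2) by (simp add: algebra_simps)
  qed
  \<comment> \<open>The leading 0 is the first column, which has nothing above the diagonal.\<close>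
  have R: "result (mv_transpose_rep \<rho> y) = map2 (+) (map2 (*) \<gamma> s) (0 # map2 (*) \<gamma>' w)"
    by (simp add: mv_transpose_rep_def Q(1) s_def w_def)
  \<comment> \<open>The length of \<open>w\<close> is \<open>Suc (N - 2)\<close>, which exceeds
    \<open>N - 1\<close> for \<open>N = 1\<close>; zipping with \<open>\<gamma>'\<close> cuts it
    off.\<close>
  have len: "length s = N" "N - 1 \<le> length w" using S(1) W(1) by auto
  show "length (result (mv_transpose_rep \<rho> y)) = N"
    using len Q(3,4) assms(3) by (simp add: R)
  show "result (mv_transpose_rep \<rho> y) ! j = (\<Sum>i<N. Q $$ (i, j) * y ! i)" if "j < N"
  proof (cases j)
    case 0
    have "(\<Sum>i<N. Q $$ (i, 0) * y ! i) = Q $$ (0, 0) * s ! 0"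
      using s[of 0 0] assms(3) by (simp add: lessThan_atLeast0)
    then show ?thesis
      using len Q(3,4) Q(7)[of 0] that 0 by (simp add: R)
  next
    case (Suc k)
    have "(\<Sum>i<N. Q $$ (i, j) * y ! i) = (\<Sum>i\<le>k. Q $$ (i, j) * y ! i) + Q $$ (j, j) * s ! j"
      using sum_split_before[OF that, of "\<lambda>i. Q $$ (i, j) * y ! i"] s[of j j] that
      by (simp add: Suc lessThan_Suc_atMost)
    also have "\<dots> = \<gamma>' ! k * w ! k + \<gamma> ! j * s ! j"
      using w[of k j] Q(7,8) that by (simp add: Suc)
    finally show ?thesis
      using len Q(3,4) that by (simp add: R Suc)
  qed
qed

lemma mv_rep_correct:
  assumes "represents N \<rho> Q" "\<psi> \<in> carrier_vec N" "0 < N"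
  shows "result (mv_rep \<rho> (list_of_vec \<psi>)) = list_of_vec (Q *\<^sub>v \<psi>)"
proof -
  have Q: "Q \<in> carrier_mat N N" using assms(1) by (rule representsE)
  have l: "length (list_of_vec \<psi>) = N" using assms(2) by simp
  show ?thesis
    using mv_rep_index[OF assms(1) l assms(3)] Q assms(2)
    by (intro nth_equalityI)
      (auto simp: list_of_vec_index scalar_prod_def atLeast0LessThan intro!: sum.cong)
qed

lemma mv_transpose_rep_correct:
  assumes "represents N \<rho> Q" "\<phi> \<in> carrier_vec N" "0 < N"
  shows "result (mv_transpose_rep \<rho> (list_of_vec \<phi>)) = list_of_vec (transpose_mat Q *\<^sub>v \<phi>)"
proof -
  have Q: "Q \<in> carrier_mat N N" using assms(1) by (rule representsE)
  have l: "length (list_of_vec \<phi>) = N" using assms(2) by simp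
  show ?thesis
    using mv_transpose_rep_index[OF assms(1) l assms(3)] Q assms(2)
    by (intro nth_equalityI)
      (auto simp: list_of_vec_index scalar_prod_def atLeast0LessThan intro!: sum.cong)
qed

lemma transport_cost_rep_correct:
  assumes "represents N \<rho> \<Gamma>" "0 < N"
  shows "result (transport_cost_rep h \<rho>) = frobenius (cost_mat N h) \<Gamma>"
proof -
  from assms(1) obtain \<gamma> \<gamma>' r r'
    where Q: "\<rho> = (\<gamma>, \<gamma>', r, r')" "\<Gamma> \<in> carrier_mat N N"
      "length \<gamma> = N" "length \<gamma>' = N - 1" "length r = N - 1" "length r' = N - 2"
      "\<And>i. i < N \<Longrightarrow> \<Gamma> $$ (i, i) = \<gamma> ! i" "\<And>i. Suc i < N \<Longrightarrow> \<Gamma> $$ (i, Suc i) = \<gamma>' ! i"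
      "\<And>i j. j \<le> i \<Longrightarrow> Suc i < N \<Longrightarrow> \<Gamma> $$ (Suc i, j) = r ! i * \<Gamma> $$ (i, j)"
      "\<And>i j. Suc i < j \<Longrightarrow> j < N \<Longrightarrow> \<Gamma> $$ (i, j) = r' ! i * \<Gamma> $$ (Suc i, j)"
    by (rule representsE) blast
  define S where "S = result (lower_rows h \<gamma> r)"
  define S' where "S' = fst (result (upper_rows h \<gamma>' r'))"
  have l: "length r = length \<gamma> - 1" "\<gamma> \<noteq> []" "length r' = length \<gamma>' - 1"
    using Q assms(2) by auto
  from lower_rows_correct[OF l(1,2), of h, folded S_def, unfolded Q(3)] obtain T
    where L: "length S = N" "S ! 0 = 0" "T ! 0 = \<gamma> ! 0"
      "\<And>i. Suc i < N \<Longrightarrow> S ! Suc i = r ! i * (S ! i + h * T ! i)"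
      "\<And>i. Suc i < N \<Longrightarrow> T ! Suc i = r ! i * T ! i + \<gamma> ! Suc i"
    by blast
  from upper_rows_correct[OF l(3), of h, folded S'_def, unfolded Q(4)] obtain T'
    where U: "length S' = Suc (N - 1)" "S' ! (N - 1) = 0"
      "\<gamma>' \<noteq> [] \<Longrightarrow> S' ! (N - 1 - 1) = h * last \<gamma>' \<and> T' ! (N - 1 - 1) = last \<gamma>'"
      "\<And>i. Suc i < N - 1 \<Longrightarrow> S' ! i = h * \<gamma>' ! i + r' ! i * (S' ! Suc i + h * T' ! Suc i)"
      "\<And>i. Suc i < N - 1 \<Longrightarrow> T' ! i = \<gamma>' ! i + r' ! i * T' ! Suc i"
    by blast
  \<comment> \<open>The two sums need one joint induction: the next row raises every earlier cost by
    \<open>h\<close>, which adds \<open>h\<close> times the plain sum. The new diagonal entry has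
    cost 0 and enters \<open>T\<close> only.\<close>
  have lo: "S ! i = (\<Sum>j\<le>i. h * (real i - real j) * \<Gamma> $$ (i, j)) \<and> T ! i = (\<Sum>j\<le>i. \<Gamma> $$ (i, j))"
    if "i < N" for i
    using that
  proof (induction i)
    case 0
    then show ?case using L(2,3) Q(7)[of 0] by simp
  next
    case (Suc i)
    then have IH: "S ! i = (\<Sum>j\<le>i. h * (real i - real j) * \<Gamma> $$ (i, j))"
      "T ! i = (\<Sum>j\<le>i. \<Gamma> $$ (i, j))" by simp_all
    have "S ! i + h * T ! i = (\<Sum>j\<le>i. h * (real (Suc i) - real j) * \<Gamma> $$ (i, j))"
      by (simp add: IH sum_distrib_left sum.distrib[symmetric] algebra_simps)
    then have "S ! Suc i = (\<Sum>j\<le>i. h * (real (Suc i) - real j) * \<Gamma> $$ (Suc i, j))"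
      using L(4)[OF Suc.prems] Suc.prems by (simp add: sum_distrib_left Q(9) ac_simps)
    moreover have "T ! Suc i = (\<Sum>j\<le>i. \<Gamma> $$ (Suc i, j)) + \<gamma> ! Suc i"
      using L(5)[OF Suc.prems] Suc.prems by (simp add: IH sum_distrib_left Q(9))
    ultimately show ?case using Q(7)[OF Suc.prems] by simp
  qed
  \<comment> \<open>The last row is excluded because \<open>U\<close> says nothing about
    \<open>T'\<close> there; its weighted sum is the 0 in \<open>U(2)\<close>.\<close>
  have up: "S' ! i = (\<Sum>j=Suc i..<N. h * (real j - real i) * \<Gamma> $$ (i, j)) \<and>
      T' ! i = (\<Sum>j=Suc i..<N. \<Gamma> $$ (i, j))" if "Suc i < N" for i
  proof -
    from that have "i \<le> N - 2" by simp
    then show ?thesis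
    proof (induction i rule: inc_induct)
      case base
      have len: "length \<gamma>' = Suc (N - 2)" using Q(4) that by simp
      have "{Suc (N - 2)..<N} = {Suc (N - 2)}" using that by auto
      moreover have "\<gamma>' \<noteq> []" using len by auto
      moreover have "\<Gamma> $$ (N - 2, Suc (N - 2)) = \<gamma>' ! (N - 2)" using that by (intro Q(8)) simp
      moreover have "N - 1 - 1 = N - 2" by simp
      ultimately show ?case using U(3) len by (simp add: last_conv_nth)
    next
      case (step i)
      then have i: "Suc i < N - 1" "Suc i < N" by simp_all
      from step have IH: "S' ! Suc i = (\<Sum>j=Suc (Suc i)..<N. h * (real j - real (Suc i)) * \<Gamma> $$ (Suc i, j))"
        "T' ! Suc i = (\<Sum>j=Suc (Suc i)..<N. \<Gamma> $$ (Suc i, j))" by blast+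
      have "S' ! Suc i + h * T' ! Suc i =
          (\<Sum>j=Suc (Suc i)..<N. h * (real j - real i) * \<Gamma> $$ (Suc i, j))"
        by (simp add: IH sum_distrib_left sum.distrib[symmetric] algebra_simps)
      then have "S' ! i = h * \<gamma>' ! i + (\<Sum>j=Suc (Suc i)..<N. h * (real j - real i) * \<Gamma> $$ (i, j))"
        using U(4)[OF i(1)] by (simp add: sum_distrib_left Q(10) ac_simps)
      moreover have "T' ! i = \<gamma>' ! i + (\<Sum>j=Suc (Suc i)..<N. \<Gamma> $$ (i, j))"
        using U(5)[OF i(1)] by (simp add: IH sum_distrib_left Q(10))
      ultimately show ?case
        using Q(8)[OF i(2)] i(2) by (simp add: sum.atLeast_Suc_lessThan[of "Suc i"])
    qed
  qed
  have row: "(\<Sum>j<N. cost_mat N h $$ (i, j) * \<Gamma> $$ (i, j)) = S ! i + S' ! i" if "i < N" for i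
  proof -
    have "(\<Sum>j\<le>i. cost_mat N h $$ (i, j) * \<Gamma> $$ (i, j)) = S ! i"
      unfolding lo[OF that, THEN conjunct1] using that by (intro sum.cong) (auto simp: cost_mat_def)
    moreover have "(\<Sum>j=Suc i..<N. cost_mat N h $$ (i, j) * \<Gamma> $$ (i, j)) = S' ! i"
    proof (cases "Suc i < N")
      case True
      show ?thesis
        unfolding up[OF True, THEN conjunct1] by (intro sum.cong) (auto simp: cost_mat_def)
    next
      case False
      with that have "N = Suc i" by simp
      then show ?thesis using U(2) by simp
    qed
    ultimately show ?thesis by (simp add: sum_split_at[OF that])
  qed
  have dim: "dim_row (cost_mat N h) = N" "dim_col (cost_mat N h) = N"
    by (simp_all add: cost_mat_def)
  have "result (transport_cost_rep h \<rho>) = sum_list S + sum_list S'"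
    by (simp add: transport_cost_rep_def Q(1) S_def S'_def split_beta)
  also have "\<dots> = (\<Sum>i<N. S ! i + S' ! i)"
    using L(1) U(1) assms(2) by (simp add: sum_list_sum_nth atLeast0LessThan sum.distrib)
  also have "\<dots> = frobenius (cost_mat N h) \<Gamma>"
    by (simp add: frobenius_def row dim)
  finally show ?thesis .
qed

section \<open>Operation counts\<close>

text \<open>Each recursive call consumes one ratio, so the ratio list alone bounds the recursion.
  The factor 4 is a tick, two products and one sum; the factors in the bounds below arise in the
  same way.\<close>

lemma cost_lower_mv_from: "cost (lower_mv_from p rs gs ys) \<le> Suc (4 * length rs)"
  by (induction p rs gs ys rule: lower_mv_from.induct) simp_all

lemma cost_lower_mv: "cost (lower_mv gs rs ys) \<le> 3 + 4 * length rs"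
  using cost_lower_mv_from by (cases "(gs, rs, ys)" rule: lower_mv.cases) (simp_all add: add.commute)

lemma cost_upper_mv: "cost (upper_mv gs rs ys) \<le> 2 + 4 * length rs"
  by (induction gs rs ys rule: upper_mv.induct) simp_all

lemma cost_backward_t: "cost (backward_t rs ys) \<le> Suc (3 * length rs)"
  by (induction rs ys rule: backward_t.induct) simp_all

lemma cost_forward_from: "cost (forward_from w rs ys) \<le> Suc (3 * length rs)"
  by (induction w rs ys rule: forward_from.induct) simp_all

lemma cost_forward_t: "cost (forward_t rs ys) \<le> 2 + 3 * length rs"
  using cost_forward_from by (cases ys) simp_all

lemma cost_lower_rows_from: "cost (lower_rows_from h S T rs gs) \<le> Suc (6 * length rs)"
  by (induction h S T rs gs rule: lower_rows_from.induct) simp_all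

lemma cost_lower_rows: "cost (lower_rows h gs rs) \<le> 2 + 6 * length rs"
  using cost_lower_rows_from by (cases gs) simp_all

lemma cost_upper_rows: "cost (upper_rows h gs rs) \<le> 2 + 8 * length rs"
  by (induction h gs rs rule: upper_rows.induct) (simp_all add: split_beta)

definition rep_lengths :: "nat \<Rightarrow> crep \<Rightarrow> bool" where
  "rep_lengths N = (\<lambda>(\<gamma>, \<gamma>', r, r').
     length \<gamma> = N \<and> length \<gamma>' = N - 1 \<and> length r = N - 1 \<and> length r' = N - 2)"

lemma represents_lengths: "represents N \<rho> M \<Longrightarrow> rep_lengths N \<rho>"
  by (erule representsE) (simp add: rep_lengths_def)

text \<open>The factor 40 is a generous common bound for all operations, with additive constants
  absorbed by \<open>1 \<le> N\<close>. The most expensive operation, the transport cost, stays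
  below \<open>18 * N\<close>.\<close>

lemma ones_rep_cost: "0 < N \<Longrightarrow> cost (ones_rep N) \<le> 40 * N"
  by (simp add: ones_rep_def)

lemma ones_rep_lengths: "rep_lengths N (result (ones_rep N))"
  by (simp add: ones_rep_def rep_lengths_def)

lemma kernel_rep_cost: "0 < N \<Longrightarrow> cost (kernel_rep N h \<delta>) \<le> 40 * N"
  by (simp add: kernel_rep_def)

lemma kernel_rep_lengths: "rep_lengths N (result (kernel_rep N h \<delta>))"
  by (simp add: kernel_rep_def rep_lengths_def)

lemma hadamard_rep_cost:
  assumes "0 < N" "rep_lengths N \<rho>1" "rep_lengths N \<rho>2"
  shows "cost (hadamard_rep \<rho>1 \<rho>2) \<le> 40 * N"
  using assms by (cases \<rho>1; cases \<rho>2) (simp add: hadamard_rep_def rep_lengths_def)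

lemma hadamard_rep_lengths:
  assumes "rep_lengths N \<rho>1" "rep_lengths N \<rho>2"
  shows "rep_lengths N (result (hadamard_rep \<rho>1 \<rho>2))"
  using assms by (cases \<rho>1; cases \<rho>2) (simp add: hadamard_rep_def rep_lengths_def)

lemma scale_rep_cost:
  assumes "0 < N" "rep_lengths N \<rho>" "length \<phi> = N" "length \<psi> = N"
  shows "cost (scale_rep \<phi> \<rho> \<psi>) \<le> 40 * N"
  using assms by (cases \<rho>) (simp add: scale_rep_def rep_lengths_def)

lemma scale_rep_lengths:
  assumes "rep_lengths N \<rho>" "length \<phi> = N" "length \<psi> = N"
  shows "rep_lengths N (result (scale_rep \<phi> \<rho> \<psi>))"
  using assms by (cases \<rho>) (simp add: scale_rep_def rep_lengths_def)

lemma mv_rep_cost: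
  assumes "0 < N" "rep_lengths N \<rho>" "length y = N"
  shows "cost (mv_rep \<rho> y) \<le> 40 * N"
proof -
  obtain \<gamma> \<gamma>' r r' where \<rho>: "\<rho> = (\<gamma>, \<gamma>', r, r')" by (cases \<rho>)
  have l: "length \<gamma> = N" "length \<gamma>' = N - 1" "length r = N - 1" "length r' = N - 2"
    using assms(2) by (simp_all add: \<rho> rep_lengths_def)
  have "length (result (lower_mv \<gamma> r y)) = N"
    using lower_mv_correct(1)[of r \<gamma> y] l assms(3) by simp
  then show ?thesis
    using cost_lower_mv[of \<gamma> r y] cost_upper_mv[of \<gamma>' r' "tl y"] l assms(1)
    by (simp add: mv_rep_def \<rho>)
qed

lemma mv_rep_length:
  assumes "0 < N" "rep_lengths N \<rho>" "length y = N"
  shows "length (result (mv_rep \<rho> y)) = N"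
proof -
  obtain \<gamma> \<gamma>' r r' where \<rho>: "\<rho> = (\<gamma>, \<gamma>', r, r')" by (cases \<rho>)
  have l: "length \<gamma> = N" "length \<gamma>' = N - 1" "length r = N - 1" "length r' = N - 2"
    using assms(2) by (simp_all add: \<rho> rep_lengths_def)
  have "length (result (lower_mv \<gamma> r y)) = N"
    using lower_mv_correct(1)[of r \<gamma> y] l assms(3) by simp
  moreover have "length (result (upper_mv \<gamma>' r' (tl y))) = N"
    using upper_mv_correct[of r' \<gamma>' "tl y", THEN conjunct1] l assms(1,3) by simp
  ultimately show ?thesis by (simp add: mv_rep_def \<rho>)
qed

lemma mv_transpose_rep_cost:
  assumes "0 < N" "rep_lengths N \<rho>" "length y = N"
  shows "cost (mv_transpose_rep \<rho> y) \<le> 40 * N"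
proof -
  obtain \<gamma> \<gamma>' r r' where \<rho>: "\<rho> = (\<gamma>, \<gamma>', r, r')" by (cases \<rho>)
  have l: "length \<gamma> = N" "length \<gamma>' = N - 1" "length r = N - 1" "length r' = N - 2"
    using assms(2) by (simp_all add: \<rho> rep_lengths_def)
  have "length (result (backward_t r y)) = N"
    using backward_t_correct[of y r, THEN conjunct1] l assms(1,3) by simp
  moreover have "length (result (forward_t r' y)) = Suc (N - 2)"
    using forward_t_correct(1)[of r' y] l assms(1,3) by simp
  ultimately show ?thesis
    using cost_backward_t[of r y] cost_forward_t[of r' y] l assms(1)
    by (simp add: mv_transpose_rep_def \<rho>)
qed

lemma mv_transpose_rep_length:
  assumes "0 < N" "rep_lengths N \<rho>" "length y = N"
  shows "length (result (mv_transpose_rep \<rho> y)) = N"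
proof -
  obtain \<gamma> \<gamma>' r r' where \<rho>: "\<rho> = (\<gamma>, \<gamma>', r, r')" by (cases \<rho>)
  have l: "length \<gamma> = N" "length \<gamma>' = N - 1" "length r = N - 1" "length r' = N - 2"
    using assms(2) by (simp_all add: \<rho> rep_lengths_def)
  have "length (result (backward_t r y)) = N"
    using backward_t_correct[of y r, THEN conjunct1] l assms(1,3) by simp
  moreover have "length (result (forward_t r' y)) = Suc (N - 2)"
    using forward_t_correct(1)[of r' y] l assms(1,3) by simp
  ultimately show ?thesis using l assms(1) by (simp add: mv_transpose_rep_def \<rho>)
qed

lemma transport_cost_rep_cost:
  assumes "0 < N" "rep_lengths N \<rho>"
  shows "cost (transport_cost_rep h \<rho>) \<le> 40 * N"
proof -
  obtain \<gamma> \<gamma>' r r' where \<rho>: "\<rho> = (\<gamma>, \<gamma>', r, r')" by (cases \<rho>)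
  have l: "length \<gamma> = N" "length \<gamma>' = N - 1" "length r = N - 1" "length r' = N - 2"
    using assms(2) by (simp_all add: \<rho> rep_lengths_def)
  have "\<gamma> \<noteq> []" using l(1) assms(1) by auto
  then have "length (result (lower_rows h \<gamma> r)) = N"
    using lower_rows_correct[of r \<gamma> h] l by auto
  moreover have "length (fst (result (upper_rows h \<gamma>' r'))) = N"
    using upper_rows_correct[of r' \<gamma>' h] l assms(1) by auto
  ultimately show ?thesis
    using cost_lower_rows[of h \<gamma> r] cost_upper_rows[of h \<gamma>' r'] l assms(1)
    by (simp add: transport_cost_rep_def \<rho> split_beta)
qed

section \<open>The FS-2 iteration\<close>

text \<open>Two products at \<open>40 * N\<close> each and two entrywise divisions at
  \<open>2 * N + 1\<close> each fit into \<open>90 * N\<close>.\<close>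

lemma fs2_inner_cost:
  assumes "0 < N" "rep_lengths N \<rho>" "length u = N" "length v = N"
    and "length (fst s) = N \<and> length (snd s) = N"
  shows "(length (fst (result (fs2_inner \<rho> u v s))) = N \<and>
      length (snd (result (fs2_inner \<rho> u v s))) = N) \<and>
    cost (fs2_inner \<rho> u v s) \<le> 90 * N"
proof -
  obtain \<phi> \<psi> where s: "s = (\<phi>, \<psi>)" by (cases s)
  define a where "a = result (mv_transpose_rep \<rho> \<phi>)"
  define \<psi>' where "\<psi>' = map2 (/) v a"
  have \<phi>: "length \<phi> = N" using assms(5) by (simp add: s)
  have "length a = N"
    unfolding a_def by (rule mv_transpose_rep_length[OF assms(1,2) \<phi>])
  then have l: "length \<psi>' = N" using assms(4) by (simp add: \<psi>'_def)
  note b = mv_rep_length[OF assms(1,2) l] mv_rep_cost[OF assms(1,2) l]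
    mv_transpose_rep_cost[OF assms(1,2) \<phi>]
  show ?thesis
    using b \<open>length a = N\<close> l assms(1,3,4)
    by (simp add: fs2_inner_def s a_def[symmetric] \<psi>'_def[symmetric])
qed

text \<open>81 is 40 for the Hadamard product, 40 for the scaling and 1 for the base tick of the
  inner loop; 91 is 90 for an inner step and 1 for its tick.\<close>

lemma fs2_outer_cost:
  assumes "0 < N" "rep_lengths N K" "length u = N" "length v = N"
    and s: "length (fst s) = N \<and> length (fst (snd s)) = N \<and> rep_lengths N (snd (snd s))"
  shows "(length (fst (result (fs2_outer K u v L s))) = N \<and>
      length (fst (snd (result (fs2_outer K u v L s)))) = N \<and>
      rep_lengths N (snd (snd (result (fs2_outer K u v L s))))) \<and>
    cost (fs2_outer K u v L s) \<le> (81 + L * 91) * N"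
proof -
  obtain \<phi> \<psi> \<Gamma> where s_eq: "s = (\<phi>, \<psi>, \<Gamma>)" by (cases s)
  define Q where "Q = result (hadamard_rep K \<Gamma>)"
  define it where "it = iterate_t L (fs2_inner Q u v) (\<phi>, \<psi>)"
  have G: "rep_lengths N \<Gamma>" using s by (simp add: s_eq)
  have Q: "rep_lengths N Q"
    unfolding Q_def using assms(2) G by (rule hadamard_rep_lengths)
  have "(length (fst (result it)) = N \<and> length (snd (result it)) = N) \<and>
      cost it \<le> Suc (L * Suc (90 * N))"
    unfolding it_def
    by (rule iterate_t_invariant[where P = "\<lambda>s. length (fst s) = N \<and> length (snd s) = N"])
      (use s s_eq fs2_inner_cost[OF assms(1) Q assms(3,4)] in auto)
  then have it: "length (fst (result it)) = N" "length (snd (result it)) = N"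
    and c: "cost it \<le> Suc (L * Suc (90 * N))" by auto
  note S = scale_rep_cost[OF assms(1) Q it] scale_rep_lengths[OF Q it]
    hadamard_rep_cost[OF assms(1,2) G]
  have "L * Suc (90 * N) \<le> L * (91 * N)"
    using assms(1) by (intro mult_le_mono2) simp
  then have "cost it \<le> N + L * 91 * N"
    unfolding mult.assoc using c assms(1) by linarith
  then show ?thesis
    using S it
    by (simp add: fs2_outer_def s_eq split_beta Q_def[symmetric] it_def[symmetric] algebra_simps)
qed

text \<open>126 is 40 for the kernel, 45 for the initial state, 1 for the base tick and 40 for the
  final value; 82 adds the tick of an outer step to 81.\<close>

lemma fs2_cost:
  assumes "0 < N" "length u = N" "length v = N"
  shows "cost (fs2 N h \<delta> u v L m) \<le> (126 + m * (82 + L * 91)) * N"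
proof -
  define K where "K = result (kernel_rep N h \<delta>)"
  define s where "s = result (fs2_init N)"
  define it where "it = iterate_t m (fs2_outer K u v L) s"
  have K: "rep_lengths N K" unfolding K_def by (rule kernel_rep_lengths)
  have s: "length (fst s) = N \<and> length (fst (snd s)) = N \<and> rep_lengths N (snd (snd s))"
    by (simp add: s_def fs2_init_def ones_rep_lengths)
  have "(length (fst (result it)) = N \<and> length (fst (snd (result it))) = N \<and>
      rep_lengths N (snd (snd (result it)))) \<and>
      cost it \<le> Suc (m * Suc ((81 + L * 91) * N))"
    unfolding it_def
    by (rule iterate_t_invariant[where P = "\<lambda>s. length (fst s) = N \<and> length (fst (snd s)) = N \<and>
          rep_lengths N (snd (snd s))", OF s fs2_outer_cost[OF assms(1) K assms(2,3)]])
  then have it: "rep_lengths N (snd (snd (result it)))"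
    and c: "cost it \<le> Suc (m * Suc ((81 + L * 91) * N))" by auto
  have "m * Suc ((81 + L * 91) * N) \<le> m * ((82 + L * 91) * N)"
    using assms(1) by (intro mult_le_mono2) (simp add: algebra_simps)
  then have c': "cost it \<le> N + m * (82 + L * 91) * N"
    unfolding mult.assoc using c assms(1) by linarith
  have i: "cost (fs2_init N) \<le> 45 * N"
    using ones_rep_cost[OF assms(1)] assms(1) by (simp add: fs2_init_def)
  have "cost (fs2 N h \<delta> u v L m) = cost (kernel_rep N h \<delta>) + cost (fs2_init N) + cost it +
      cost (transport_cost_rep h (snd (snd (result it))))"
    by (simp add: fs2_def fs2_state_def split_beta K_def[symmetric] s_def[symmetric]
        it_def[symmetric])
  also have "\<dots> \<le> 40 * N + 45 * N + (N + m * (82 + L * 91) * N) + 40 * N"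
    by (intro add_mono kernel_rep_cost transport_cost_rep_cost i c' it assms(1))
  also have "\<dots> = (126 + m * (82 + L * 91)) * N"
    by (simp add: algebra_simps)
  finally show ?thesis .
qed

section \<open>Simulation of the matrix iteration by the list iteration\<close>

lemma map2_divide_list_of_vec:
  "dim_vec x = dim_vec y \<Longrightarrow> map2 (/) (list_of_vec x) (list_of_vec y) = list_of_vec (x \<oslash>\<^sub>v y)"
  by (intro nth_equalityI) (auto simp: vec_divide_def list_of_vec_index)

text \<open>The incoming \<psi> is overwritten before it is read, so only \<phi> has to be of the
  right dimension. Zero denominators do no harm here: lists and vectors use the same division on
  \<open>real\<close>.\<close>

lemma fs2_inner_correct:
  assumes "represents N \<rho> Q" "0 < N" "u \<in> carrier_vec N" "v \<in> carrier_vec N" "\<phi> \<in> carrier_vec N"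
  shows "result (fs2_inner \<rho> (list_of_vec u) (list_of_vec v) (list_of_vec \<phi>, list_of_vec \<psi>)) =
      map_prod list_of_vec list_of_vec (ipot_inner Q u v (\<phi>, \<psi>))"
    "fst (ipot_inner Q u v (\<phi>, \<psi>)) \<in> carrier_vec N"
    "snd (ipot_inner Q u v (\<phi>, \<psi>)) \<in> carrier_vec N"
proof -
  have Q: "Q \<in> carrier_mat N N" using assms(1) by (rule representsE)
  define \<psi>' where "\<psi>' = v \<oslash>\<^sub>v (transpose_mat Q *\<^sub>v \<phi>)"
  have \<psi>': "\<psi>' \<in> carrier_vec N" using assms(4) by (auto simp: \<psi>'_def vec_divide_def)
  have 1: "map2 (/) (list_of_vec v) (list_of_vec (transpose_mat Q *\<^sub>v \<phi>)) = list_of_vec \<psi>'"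
    unfolding \<psi>'_def by (rule map2_divide_list_of_vec) (use Q assms(4) in auto)
  have 2: "map2 (/) (list_of_vec u) (list_of_vec (Q *\<^sub>v \<psi>')) = list_of_vec (u \<oslash>\<^sub>v (Q *\<^sub>v \<psi>'))"
    by (rule map2_divide_list_of_vec) (use Q assms(3) in auto)
  have I: "ipot_inner Q u v (\<phi>, \<psi>) = (u \<oslash>\<^sub>v (Q *\<^sub>v \<psi>'), \<psi>')"
    by (simp add: ipot_inner_def \<psi>'_def Let_def)
  show "result (fs2_inner \<rho> (list_of_vec u) (list_of_vec v) (list_of_vec \<phi>, list_of_vec \<psi>)) =
      map_prod list_of_vec list_of_vec (ipot_inner Q u v (\<phi>, \<psi>))"
    by (simp add: fs2_inner_def I mv_transpose_rep_correct[OF assms(1,5,2)] 1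
        mv_rep_correct[OF assms(1) \<psi>' assms(2)] 2)
  show "fst (ipot_inner Q u v (\<phi>, \<psi>)) \<in> carrier_vec N"
    "snd (ipot_inner Q u v (\<phi>, \<psi>)) \<in> carrier_vec N"
    using \<psi>' assms(3) by (auto simp: I vec_divide_def)
qed

lemma fs2_inner_iterate_correct:
  assumes "represents N \<rho> Q" "0 < N" "u \<in> carrier_vec N" "v \<in> carrier_vec N"
    and "\<phi> \<in> carrier_vec N" "\<psi> \<in> carrier_vec N"
  shows "result (iterate_t l (fs2_inner \<rho> (list_of_vec u) (list_of_vec v))
        (list_of_vec \<phi>, list_of_vec \<psi>)) =
      map_prod list_of_vec list_of_vec ((ipot_inner Q u v ^^ l) (\<phi>, \<psi>)) \<and>
    fst ((ipot_inner Q u v ^^ l) (\<phi>, \<psi>)) \<in> carrier_vec N \<and>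
    snd ((ipot_inner Q u v ^^ l) (\<phi>, \<psi>)) \<in> carrier_vec N"
proof (induction l)
  case (Suc l)
  obtain \<phi>' \<psi>' where eq: "(ipot_inner Q u v ^^ l) (\<phi>, \<psi>) = (\<phi>', \<psi>')"
    by (cases "(ipot_inner Q u v ^^ l) (\<phi>, \<psi>)")
  with Suc have c: "\<phi>' \<in> carrier_vec N" by simp
  show ?case
    using Suc fs2_inner_correct[OF assms(1-4) c, of \<psi>'] by (simp add: eq)
qed (simp add: assms)

lemma fs2_state_correct:
  assumes "0 < N" "u \<in> carrier_vec N" "v \<in> carrier_vec N"
    and "\<forall>t\<in>{1..m}. nonzero_vec N (ipot_phi N h \<delta> u v L t) \<and>
      nonzero_vec N (ipot_psi N h \<delta> u v L t)"
    and "t \<le> m"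
  shows "\<exists>\<rho>. result (fs2_state N h \<delta> (list_of_vec u) (list_of_vec v) L t) =
      (list_of_vec (ipot_phi N h \<delta> u v L t), list_of_vec (ipot_psi N h \<delta> u v L t), \<rho>) \<and>
    represents N \<rho> (ipot_plan N h \<delta> u v L t) \<and>
    ipot_phi N h \<delta> u v L t \<in> carrier_vec N \<and> ipot_psi N h \<delta> u v L t \<in> carrier_vec N"
  using assms(5)
proof (induction t)
  case 0
  have "list_of_vec (vec N (\<lambda>_. c)) = replicate N c" for c :: real
    by (intro nth_equalityI) (auto simp: list_of_vec_index)
  then show ?case
    by (simp add: fs2_state_def fs2_init_def ipot_phi_def ipot_psi_def ipot_plan_def
        ipot_state_def ipot_init_def represents_ones)
next
  case (Suc t)
  let ?K = "kernel_mat N h \<delta>"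
  let ?k = "result (kernel_rep N h \<delta>)"
  define \<phi> where "\<phi> = ipot_phi N h \<delta> u v L t"
  define \<psi> where "\<psi> = ipot_psi N h \<delta> u v L t"
  define \<Gamma> where "\<Gamma> = ipot_plan N h \<delta> u v L t"
  from Suc obtain \<rho>
    where S: "result (fs2_state N h \<delta> (list_of_vec u) (list_of_vec v) L t) =
        (list_of_vec \<phi>, list_of_vec \<psi>, \<rho>)"
      and \<rho>: "represents N \<rho> \<Gamma>" and c: "\<phi> \<in> carrier_vec N" "\<psi> \<in> carrier_vec N"
    unfolding \<phi>_def \<psi>_def \<Gamma>_def by auto
  define \<sigma> where "\<sigma> = result (hadamard_rep ?k \<rho>)"
  have \<sigma>: "represents N \<sigma> (?K \<odot>\<^sub>m \<Gamma>)"
    unfolding \<sigma>_def using represents_kernel \<rho> by (rule represents_hadamard)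
  obtain \<phi>' \<psi>' where I: "(ipot_inner (?K \<odot>\<^sub>m \<Gamma>) u v ^^ L) (\<phi>, \<psi>) = (\<phi>', \<psi>')"
    by (cases "(ipot_inner (?K \<odot>\<^sub>m \<Gamma>) u v ^^ L) (\<phi>, \<psi>)")
  have it: "result (iterate_t L (fs2_inner \<sigma> (list_of_vec u) (list_of_vec v))
      (list_of_vec \<phi>, list_of_vec \<psi>)) = (list_of_vec \<phi>', list_of_vec \<psi>')"
    using fs2_inner_iterate_correct[OF \<sigma> assms(1-3) c, of L] by (simp add: I)
  have "ipot_state N h \<delta> u v L t = (\<phi>, \<psi>, \<Gamma>)"
    by (simp add: \<phi>_def \<psi>_def \<Gamma>_def ipot_phi_def ipot_psi_def ipot_plan_def)
  then have "ipot_state N h \<delta> u v L (Suc t) = (\<phi>', \<psi>', diag_of \<phi>' * (?K \<odot>\<^sub>m \<Gamma>) * diag_of \<psi>')"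
    by (simp add: ipot_state_def ipot_outer_def I)
  then have P: "ipot_phi N h \<delta> u v L (Suc t) = \<phi>'" "ipot_psi N h \<delta> u v L (Suc t) = \<psi>'"
    "ipot_plan N h \<delta> u v L (Suc t) = diag_of \<phi>' * (?K \<odot>\<^sub>m \<Gamma>) * diag_of \<psi>'"
    by (simp_all add: ipot_phi_def ipot_psi_def ipot_plan_def)
  \<comment> \<open>Nonvanishing is used only here, for the vectors that have just been computed.
    The initial vectors never scale anything, hence the index range starts at 1.\<close>
  have nz: "nonzero_vec N \<phi>'" "nonzero_vec N \<psi>'"
    using assms(4)[rule_format, of "Suc t"] Suc.prems by (simp_all add: P)
  have "result (fs2_state N h \<delta> (list_of_vec u) (list_of_vec v) L (Suc t)) =
      result (fs2_outer ?k (list_of_vec u) (list_of_vec v) L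
        (result (fs2_state N h \<delta> (list_of_vec u) (list_of_vec v) L t)))"
    by (simp add: fs2_state_def)
  also have "\<dots> = (list_of_vec \<phi>', list_of_vec \<psi>',
      result (scale_rep (list_of_vec \<phi>') \<sigma> (list_of_vec \<psi>')))"
    by (simp add: S fs2_outer_def \<sigma>_def[symmetric] it)
  finally show ?case
    using represents_scale[OF \<sigma> nz] nz by (simp add: P nonzero_vec_def)
qed

lemma fs2_correct:
  assumes "0 < N" "u \<in> carrier_vec N" "v \<in> carrier_vec N"
    and "\<forall>t\<in>{1..m}. nonzero_vec N (ipot_phi N h \<delta> u v L t) \<and>
      nonzero_vec N (ipot_psi N h \<delta> u v L t)"
  shows "result (fs2 N h \<delta> (list_of_vec u) (list_of_vec v) L m) = ipot N h \<delta> u v L m"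
proof -
  from fs2_state_correct[OF assms order_refl] obtain \<rho> where
    "result (fs2_state N h \<delta> (list_of_vec u) (list_of_vec v) L m) =
      (list_of_vec (ipot_phi N h \<delta> u v L m), list_of_vec (ipot_psi N h \<delta> u v L m), \<rho>)"
    "represents N \<rho> (ipot_plan N h \<delta> u v L m)" by auto
  then show ?thesis
    using transport_cost_rep_correct[of N \<rho> _ h] assms(1) by (simp add: fs2_def ipot_def)
qed

theorem mainTheorem2:
  shows
    "(\<exists>c::nat. \<forall>(N::nat) (h::real) (\<delta>::real). 0 < N \<and> 0 < h \<and> 0 < \<delta> \<longrightarrow>
       (ones_mat N \<in> C_mats N \<and>
        (\<forall>M. represents N (result (ones_rep N)) M \<longleftrightarrow> M = ones_mat N) \<and>
        cost (ones_rep N) \<le> c * N) \<and>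
       (kernel_mat N h \<delta> \<in> C_mats N \<and>
        represents N (result (kernel_rep N h \<delta>)) (kernel_mat N h \<delta>) \<and>
        cost (kernel_rep N h \<delta>) \<le> c * N) \<and>
       (\<forall>\<rho> \<Gamma>. represents N \<rho> \<Gamma> \<longrightarrow>
          kernel_mat N h \<delta> \<odot>\<^sub>m \<Gamma> \<in> C_mats N \<and>
          represents N (result (hadamard_rep (result (kernel_rep N h \<delta>)) \<rho>))
            (kernel_mat N h \<delta> \<odot>\<^sub>m \<Gamma>) \<and>
          cost (hadamard_rep (result (kernel_rep N h \<delta>)) \<rho>) \<le> c * N) \<and>
       (\<forall>\<rho> Q \<phi> \<psi>. represents N \<rho> Q \<and> \<phi> \<in> carrier_vec N \<and> \<psi> \<in> carrier_vec N \<longrightarrow>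
          vec_of_list (result (mv_transpose_rep \<rho> (list_of_vec \<phi>))) = transpose_mat Q *\<^sub>v \<phi> \<and>
          cost (mv_transpose_rep \<rho> (list_of_vec \<phi>)) \<le> c * N \<and>
          vec_of_list (result (mv_rep \<rho> (list_of_vec \<psi>))) = Q *\<^sub>v \<psi> \<and>
          cost (mv_rep \<rho> (list_of_vec \<psi>)) \<le> c * N) \<and>
       (\<forall>\<rho> Q \<phi> \<psi>. represents N \<rho> Q \<and> nonzero_vec N \<phi> \<and> nonzero_vec N \<psi> \<longrightarrow>
          diag_of \<phi> * Q * diag_of \<psi> \<in> C_mats N \<and>
          represents N (result (scale_rep (list_of_vec \<phi>) \<rho> (list_of_vec \<psi>)))
            (diag_of \<phi> * Q * diag_of \<psi>) \<and>
          cost (scale_rep (list_of_vec \<phi>) \<rho> (list_of_vec \<psi>)) \<le> c * N) \<and>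
       (\<forall>\<rho> \<Gamma>. represents N \<rho> \<Gamma> \<longrightarrow>
          result (transport_cost_rep h \<rho>) = frobenius (cost_mat N h) \<Gamma> \<and>
          cost (transport_cost_rep h \<rho>) \<le> c * N)) \<and>
     (\<forall>(itr_max::nat) (L::nat). 0 < itr_max \<and> 0 < L \<longrightarrow>
       (\<exists>c::nat. \<forall>(N::nat) (h::real) (\<delta>::real) u v.
          0 < N \<and> 0 < h \<and> 0 < \<delta> \<and> prob_vec N u \<and> prob_vec N v \<longrightarrow>
          cost (fs2 N h \<delta> (list_of_vec u) (list_of_vec v) L itr_max) \<le> c * N \<and>
          ((\<forall>t\<in>{1..itr_max}. nonzero_vec N (ipot_phi N h \<delta> u v L t) \<and>
                             nonzero_vec N (ipot_psi N h \<delta> u v L t)) \<longrightarrow>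
             (\<forall>t\<le>itr_max.
                ipot_plan N h \<delta> u v L t \<in> C_mats N \<and>
                kernel_mat N h \<delta> \<odot>\<^sub>m ipot_plan N h \<delta> u v L t \<in> C_mats N \<and>
                (case result (fs2_state N h \<delta> (list_of_vec u) (list_of_vec v) L t) of
                   (\<phi>, \<psi>, \<rho>) \<Rightarrow>
                     vec_of_list \<phi> = ipot_phi N h \<delta> u v L t \<and>
                     vec_of_list \<psi> = ipot_psi N h \<delta> u v L t \<and>
                     represents N \<rho> (ipot_plan N h \<delta> u v L t))) \<and>
             result (fs2 N h \<delta> (list_of_vec u) (list_of_vec v) L itr_max) =
               ipot N h \<delta> u v L itr_max)))"
proof (intro conjI allI impI, goal_cases)
  case 1
  \<comment> \<open>The converse direction, that the four vectors leave no other matrix, is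
    uniqueness of the represented matrix.\<close>
  have "represents N (result (ones_rep N)) M \<longleftrightarrow> M = ones_mat N" for N M
    using represents_ones represents_unique by blast
  then show ?case
    by (intro exI[of _ 40] allI impI conjI)
      (auto intro!: represents_C_mats represents_ones represents_kernel represents_hadamard
        represents_scale ones_rep_cost kernel_rep_cost hadamard_rep_cost kernel_rep_lengths
        scale_rep_cost mv_rep_cost mv_transpose_rep_cost transport_cost_rep_cost
        transport_cost_rep_correct
        dest: represents_lengths
        simp: mv_rep_correct mv_transpose_rep_correct vec_list nonzero_vec_def)
next
  case (2 m L)
  show ?case
  proof (intro exI[of _ "126 + m * (82 + L * 91)"] allI impI, goal_cases)
    case (1 N h \<delta> u v)
    then have N: "0 < N" and uv: "u \<in> carrier_vec N" "v \<in> carrier_vec N"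
      by (auto simp: prob_vec_def)
    let ?nz = "\<forall>t\<in>{1..m}. nonzero_vec N (ipot_phi N h \<delta> u v L t) \<and>
      nonzero_vec N (ipot_psi N h \<delta> u v L t)"
    have c: "cost (fs2 N h \<delta> (list_of_vec u) (list_of_vec v) L m) \<le> (126 + m * (82 + L * 91)) * N"
      by (rule fs2_cost) (use N uv in auto)
    have s: "ipot_plan N h \<delta> u v L t \<in> C_mats N \<and>
        kernel_mat N h \<delta> \<odot>\<^sub>m ipot_plan N h \<delta> u v L t \<in> C_mats N \<and>
        (case result (fs2_state N h \<delta> (list_of_vec u) (list_of_vec v) L t) of
           (\<phi>, \<psi>, \<rho>) \<Rightarrow>
             vec_of_list \<phi> = ipot_phi N h \<delta> u v L t \<and>
             vec_of_list \<psi> = ipot_psi N h \<delta> u v L t \<and>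
             represents N \<rho> (ipot_plan N h \<delta> u v L t))"
      if nz: ?nz and t: "t \<le> m" for t
    proof -
      from fs2_state_correct[OF N uv nz t] obtain \<rho> where
        "result (fs2_state N h \<delta> (list_of_vec u) (list_of_vec v) L t) =
          (list_of_vec (ipot_phi N h \<delta> u v L t), list_of_vec (ipot_psi N h \<delta> u v L t), \<rho>)"
        and \<rho>: "represents N \<rho> (ipot_plan N h \<delta> u v L t)" by blast
      then show ?thesis
        using represents_C_mats[OF \<rho>]
          represents_C_mats[OF represents_hadamard[OF represents_kernel \<rho>]]
        by (simp add: vec_list)
    qed
    show ?case
    proof (rule conjI[OF c], rule impI, rule conjI, goal_cases)
      case 1
      then show ?case by (intro allI impI) (rule s)
    next
      case 2
      then show ?case by (rule fs2_correct[OF N uv])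
    qed
  qed
qed

end
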